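(* Let $\Omega$ be an exceptional immersed domain which has finite connectivity (i.e. $\partial\Omega$ has finitely many connected components) and embedded ends, and which is not isometric to a closed half-plane. Let $u$ be its associated function. Then $|\nabla u|<1$ at every interior point of $\Omega$.
   Context: An immersed domain is a smooth, connected, complete (as a metric space), flat 2-dimensional Riemannian manifold-with-boundary $\Omega$ with non-empty boundary, for which there exists a globally defined local isometry $f:\Omega\to\mathbb{C}$, called the developing map. The interior is $\mathring\Omega=\Omega\setminus\partial\Omega$. $\Omega$ has embedded ends if the developing map is injective on each end of $\Omega$, where an end is an unbounded connected component of the complement of a sufficiently large compact subset of $\Omega$. An immersed domain is exceptional if there is a function $u$, harmonic for the metric of $\Omega$ in $\mathring\Omega$ and $C^1$ up to the boundary, with $u>0$ in $\mathring\Omega$, $u=0$ on $\partial\Omega$ and $|\nabla u|=1$ on $\partial\Omega$, where gradients are taken with respect to the metric of $\Omega$. This $u$ is called the associated function. *)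

theory Defs
  imports "HOL-Analysis.Analysis"
begin

definition curve_length :: "(real \<Rightarrow> complex) \<Rightarrow> ereal" where
  "curve_length g = (SUP P \<in> {(n, t). t 0 = (0::real) \<and> t n = 1 \<and> (\<forall>i<n. t i \<le> t (Suc i))}.
      ereal (\<Sum>i<fst P. norm (g (snd P (Suc i)) - g (snd P i))))"

(* Intrinsic (path-length) distance of the flat metric pulled back by the developing map f *)
definition idist :: "'a topology \<Rightarrow> ('a \<Rightarrow> complex) \<Rightarrow> 'a \<Rightarrow> 'a \<Rightarrow> ereal" where
  "idist X f p q = (INF \<gamma> \<in> {\<gamma>. continuous_map (top_of_set {0..1}) X \<gamma> \<and> \<gamma> 0 = p \<and> \<gamma> 1 = q}.
      curve_length (f \<circ> \<gamma>))"

definition smooth_real :: "(real \<Rightarrow> real) \<Rightarrow> bool" where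
  "smooth_real h \<longleftrightarrow> (\<forall>k x. ((deriv ^^ k) h) differentiable (at x))"

definition chart_on :: "'a topology \<Rightarrow> ('a \<Rightarrow> complex) \<Rightarrow> 'a set \<Rightarrow> bool" where
  "chart_on X f U \<longleftrightarrow> openin X U \<and> homeomorphic_map (subtopology X U) (top_of_set (f ` U)) f"

definition interior_pt :: "'a topology \<Rightarrow> ('a \<Rightarrow> complex) \<Rightarrow> 'a \<Rightarrow> bool" where
  "interior_pt X f p \<longleftrightarrow> (\<exists>U. p \<in> U \<and> chart_on X f U \<and> open (f ` U))"

definition bdry :: "'a topology \<Rightarrow> ('a \<Rightarrow> complex) \<Rightarrow> 'a set" where
  "bdry X f = {p \<in> topspace X. \<not> interior_pt X f p}"

definition interior_pts :: "'a topology \<Rightarrow> ('a \<Rightarrow> complex) \<Rightarrow> 'a set" where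
  "interior_pts X f = {p \<in> topspace X. interior_pt X f p}"

(* Local model of a smooth flat surface with boundary, via the developing map:
   f maps a neighbourhood of p homeomorphically onto W \<inter> S, with W open and
   S either the whole plane or (a rigid motion of) the closed supergraph of a smooth function. *)
definition local_model :: "'a topology \<Rightarrow> ('a \<Rightarrow> complex) \<Rightarrow> 'a \<Rightarrow> bool" where
  "local_model X f p \<longleftrightarrow> (\<exists>U W. p \<in> U \<and> chart_on X f U \<and> open W \<and>
      (f ` U = W \<or>
       (\<exists>a c h. norm a = 1 \<and> smooth_real h \<and>
          f ` U = W \<inter> {z. Im (a * (z - c)) \<ge> h (Re (a * (z - c)))})))"

definition idist_bounded :: "'a topology \<Rightarrow> ('a \<Rightarrow> complex) \<Rightarrow> 'a set \<Rightarrow> bool" where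
  "idist_bounded X f E \<longleftrightarrow> (\<exists>p\<in>topspace X. \<exists>r::real. \<forall>x\<in>E. idist X f p x \<le> ereal r)"

definition idist_complete :: "'a topology \<Rightarrow> ('a \<Rightarrow> complex) \<Rightarrow> bool" where
  "idist_complete X f \<longleftrightarrow> (\<forall>x. (\<forall>n. x n \<in> topspace X) \<longrightarrow>
      (\<forall>e>0. \<exists>N. \<forall>m\<ge>N. \<forall>n\<ge>N. idist X f (x m) (x n) < ereal e) \<longrightarrow>
      (\<exists>q\<in>topspace X. ((\<lambda>n. idist X f (x n) q) \<longlongrightarrow> 0) sequentially))"

(* Omega = (topspace X) with developing map f is an immersed domain *)
definition immersed_domain :: "'a topology \<Rightarrow> ('a \<Rightarrow> complex) \<Rightarrow> bool" where
  "immersed_domain X f \<longleftrightarrow> topspace X \<noteq> {} \<and> connected_space X \<and> Hausdorff_space X \<and>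
     (\<forall>p\<in>topspace X. local_model X f p) \<and> bdry X f \<noteq> {} \<and> idist_complete X f"

definition finite_connectivity :: "'a topology \<Rightarrow> ('a \<Rightarrow> complex) \<Rightarrow> bool" where
  "finite_connectivity X f \<longleftrightarrow> finite (connected_components_of (subtopology X (bdry X f)))"

definition embedded_ends :: "'a topology \<Rightarrow> ('a \<Rightarrow> complex) \<Rightarrow> bool" where
  "embedded_ends X f \<longleftrightarrow> (\<exists>K. compactin X K \<and>
      (\<forall>E \<in> connected_components_of (subtopology X (topspace X - K)).
          \<not> idist_bounded X f E \<longrightarrow> inj_on f E))"

definition isometric_to_closed_halfplane :: "'a topology \<Rightarrow> ('a \<Rightarrow> complex) \<Rightarrow> bool" where
  "isometric_to_closed_halfplane X f \<longleftrightarrow> (\<exists>h. bij_betw h (topspace X) {z. Im z \<ge> 0} \<and>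
      (\<forall>p\<in>topspace X. \<forall>q\<in>topspace X. idist X f p q = ereal (dist (h p) (h q))))"

definition harmonic_on :: "complex set \<Rightarrow> (complex \<Rightarrow> real) \<Rightarrow> bool" where
  "harmonic_on V v \<longleftrightarrow> open V \<and> (\<exists>G DG.
      (\<forall>z\<in>V. (v has_derivative (\<lambda>w. G z \<bullet> w)) (at z) \<and> (G has_derivative DG z) (at z)) \<and>
      continuous_on V (\<lambda>z. DG z 1) \<and> continuous_on V (\<lambda>z. DG z \<i>) \<and>
      (\<forall>z\<in>V. Re (DG z 1) + Im (DG z \<i>) = 0))"

(* u is an associated function of (X,f), with gu the (continuous up to the boundary)
   gradient of u, expressed in the developing coordinates *)
definition associated_function ::
  "'a topology \<Rightarrow> ('a \<Rightarrow> complex) \<Rightarrow> ('a \<Rightarrow> real) \<Rightarrow> ('a \<Rightarrow> complex) \<Rightarrow> bool" where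
  "associated_function X f u gu \<longleftrightarrow>
     continuous_map X euclideanreal u \<and> continuous_map X euclidean gu \<and>
     (\<forall>p\<in>interior_pts X f. u p > 0 \<and>
        (\<exists>U. p \<in> U \<and> chart_on X f U \<and> open (f ` U) \<and>
             harmonic_on (f ` U) (u \<circ> inv_into U f) \<and>
             ((u \<circ> inv_into U f) has_derivative (\<lambda>w. gu p \<bullet> w)) (at (f p)))) \<and>
     (\<forall>p\<in>bdry X f. u p = 0 \<and> norm (gu p) = 1)"

definition exceptional :: "'a topology \<Rightarrow> ('a \<Rightarrow> complex) \<Rightarrow> bool" where
  "exceptional X f \<longleftrightarrow> immersed_domain X f \<and> (\<exists>u gu. associated_function X f u gu)"

end

(*
  The gradient bound is a blow-up-free version of the classical argument for one-phase Bernoulli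
  problems. Around an interior point p take the largest open disc that lifts to the surface; by
  completeness its closure lifts as well, and the closed lift meets the boundary at some point q
  unless discs of every radius lift. On the disc u is the real part of a holomorphic function with
  positive real part, so the half-plane Schwarz-Pick inequality makes
  u (1 + t) / (1 - t) nondecreasing along the radius towards q; since |grad u| = 1 at q this gives
  u (r q) <= 2 (1 - r) / (1 + r) in normalised coordinates, and in particular |grad u| <= 4.
  Let M be the supremum of |grad u| and suppose |grad u| is almost M at the centre. Then by Harnack
  the derivative of u along some radius stays almost -M, and positivity of u forces u >= M - o(1) at
  the centre. As u is M-Lipschitz, M <= M r + 2 (1 - r) / (1 + r) for all r < 1, whence M <= 1.
  If |grad u| = 1 at an interior point, the maximum principle makes u affine on lifted discs, whose
  radius is then exactly u at the centre; discs centred further and further up exhaust a half-plane,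
  and its closure lifts onto the whole surface isometrically.
*)
theory Submission
  imports Defs "HOL-Complex_Analysis.Complex_Analysis"
begin

section \<open>Positive harmonic functions on the unit disc\<close>

text \<open>The map \<open>f\<close> is not injective, so no global coordinate is available. Every
  local statement is pulled back along a section \<open>s\<close> with \<open>f (s z) = z\<close>,
  which turns \<open>u\<close> into a harmonic function on a plane disc. The surface carries an
  abstract topology while completeness speaks of path length; the two are compared through the
  closedness of the supergraph in the local model. The supremum M need not be attained, and no
  compactness is at hand to pass to a limit solution. Hence the estimates are quantitative: they
  hold at a point where the gradient is only nearly maximal, and the error is sent to 0 before the
  radius is chosen. The profile 2 (1 - t) / (1 + t) is the restriction to a radius of 2 Re ((1 - z)
  / (1 + z)), a Poisson kernel with its pole opposite the contact point; the factor 2 normalises its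
  slope at the contact point to 1.\<close>

lemma second_difference_estimate:
  fixes v :: "complex \<Rightarrow> real" and G :: "complex \<Rightarrow> complex"
  assumes V: "open V" "z \<in> V"
    and v: "\<And>w. w \<in> V \<Longrightarrow> (v has_derivative (\<lambda>h. G w \<bullet> h)) (at w)"
    and G: "(G has_derivative D) (at z)"
    and a: "norm a = 1" and b: "norm b = 1" and "e > 0"
  shows "\<exists>d>0. \<forall>t. 0 < t \<and> t < d \<longrightarrow>
    \<bar>v (z + t *\<^sub>R a + t *\<^sub>R b) - v (z + t *\<^sub>R a) - v (z + t *\<^sub>R b) + v z - t\<^sup>2 * (D b \<bullet> a)\<bar> \<le> e * t\<^sup>2"
proof -
  obtain r where r: "r > 0" "ball z r \<subseteq> V" using V open_contains_ball by blast
  have B: "z + y \<in> V" if "norm y < r" for y using that r(2) by (auto simp: subset_iff dist_norm)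
  have lin: "bounded_linear D" using G by (rule has_derivative_bounded_linear)
  have "e/3 > 0" using \<open>e > 0\<close> by simp
  then obtain s where s: "s > 0"
    "\<And>w. norm (w - z) < s \<Longrightarrow> norm (G w - G z - D (w - z)) \<le> e/3 * norm (w - z)"
    using G unfolding has_derivative_at_alt by blast
  have s2: "norm (G (z + y) - G z - D y) \<le> e/3 * norm y" if "norm y < s" for y
    using s(2)[of "z + y"] that by simp
  have "\<bar>v (z + t *\<^sub>R a + t *\<^sub>R b) - v (z + t *\<^sub>R a) - v (z + t *\<^sub>R b) + v z - t\<^sup>2 * (D b \<bullet> a)\<bar> \<le> e * t\<^sup>2"
    if t: "0 < t" "t < min r s / 2" for t
  proof -
    \<comment> \<open>The second difference is the increment of \<open>q\<close> over [0, t]. The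
      mean value theorem leaves a difference of two values of \<open>G\<close>, which
      differentiability at \<open>z\<close> linearises. The displacements have length at most 2t and
      t, hence the thirds in \<open>e/3\<close>.\<close>
    define q where "q x = v (z + x *\<^sub>R a + t *\<^sub>R b) - v (z + x *\<^sub>R a)" for x
    have n1: "norm (x *\<^sub>R a + t *\<^sub>R b) \<le> 2 * t" and n2: "norm (x *\<^sub>R a) \<le> t" if "0 \<le> x" "x \<le> t" for x
      using norm_triangle_ineq[of "x *\<^sub>R a" "t *\<^sub>R b"] that a b t by auto
    have inV: "z + x *\<^sub>R a + t *\<^sub>R b \<in> V" "z + x *\<^sub>R a \<in> V" if "0 \<le> x" "x \<le> t" for x
    proof -
      have "norm (x *\<^sub>R a + t *\<^sub>R b) < r" "norm (x *\<^sub>R a) < r" using n1[OF that] n2[OF that] t by linarith+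
      then show "z + x *\<^sub>R a + t *\<^sub>R b \<in> V" "z + x *\<^sub>R a \<in> V"
        using B[of "x *\<^sub>R a + t *\<^sub>R b"] B[of "x *\<^sub>R a"] by (auto simp: add.assoc)
    qed
    have dq: "(q has_derivative (\<lambda>h. h * ((G (z + x *\<^sub>R a + t *\<^sub>R b) - G (z + x *\<^sub>R a)) \<bullet> a))) (at x)"
      if "0 \<le> x" "x \<le> t" for x
    proof -
      have 1: "((\<lambda>x. z + x *\<^sub>R a + t *\<^sub>R b) has_derivative (\<lambda>h. h *\<^sub>R a)) (at x)"
        and 2: "((\<lambda>x. z + x *\<^sub>R a) has_derivative (\<lambda>h. h *\<^sub>R a)) (at x)"
        by (auto intro!: derivative_eq_intros)
      show ?thesis unfolding q_def
        by (rule has_derivative_eq_rhs, rule has_derivative_diff[OF has_derivative_compose[OF 1 v[OF inV(1)[OF that]]] has_derivative_compose[OF 2 v[OF inV(2)[OF that]]]])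
          (auto simp: inner_diff_left algebra_simps)
    qed
    obtain x where x: "0 < x" "x < t" "q t - q 0 = t * ((G (z + x *\<^sub>R a + t *\<^sub>R b) - G (z + x *\<^sub>R a)) \<bullet> a)"
      using mvt_simple[OF t(1) has_derivative_at_withinI[OF dq]] by auto
    define E1 where "E1 = G (z + x *\<^sub>R a + t *\<^sub>R b) - G z - D (x *\<^sub>R a + t *\<^sub>R b)"
    define E2 where "E2 = G (z + x *\<^sub>R a) - G z - D (x *\<^sub>R a)"
    have "norm E1 \<le> e/3 * norm (x *\<^sub>R a + t *\<^sub>R b)"
      unfolding E1_def add.assoc using n1[of x] x t by (intro s2) auto
    also have "\<dots> \<le> e/3 * (2*t)" using n1[of x] x \<open>e>0\<close> by (intro mult_left_mono) auto
    finally have E1: "norm E1 \<le> e/3 * (2*t)" .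
    have "norm E2 \<le> e/3 * norm (x *\<^sub>R a)"
      unfolding E2_def using n2[of x] x t by (intro s2) auto
    also have "\<dots> \<le> e/3 * t" using n2[of x] x \<open>e>0\<close> by (intro mult_left_mono) auto
    finally have E2: "norm E2 \<le> e/3 * t" .
    have "G (z + x *\<^sub>R a + t *\<^sub>R b) - G (z + x *\<^sub>R a) = t *\<^sub>R D b + (E1 - E2)"
      unfolding E1_def E2_def using linear_add[OF bounded_linear.linear[OF lin]] linear_scale[OF bounded_linear.linear[OF lin]]
      by simp
    note eqG = this
    have "q t - q 0 - t\<^sup>2 * (D b \<bullet> a) = t * ((E1 - E2) \<bullet> a)"
      unfolding x(3) eqG by (simp add: inner_add_left power2_eq_square algebra_simps)
    moreover have "\<bar>(E1 - E2) \<bullet> a\<bar> \<le> e * t"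
      using Cauchy_Schwarz_ineq2[of "E1 - E2" a] a norm_triangle_ineq4[of E1 E2] E1 E2 by simp
    ultimately have "\<bar>q t - q 0 - t\<^sup>2 * (D b \<bullet> a)\<bar> \<le> t * (e * t)"
      using t by (simp add: abs_mult)
    then show ?thesis unfolding q_def by (simp add: power2_eq_square algebra_simps)
  qed
  then show ?thesis using r(1) s(1) by (intro exI[of _ "min r s / 2"]) auto
qed

text \<open>The mixed second difference is unchanged when \<open>a\<close> and \<open>b\<close> are
  exchanged, so both inner products approximate it after division by the square of
  \<open>t\<close>.\<close>

lemma second_derivative_symmetric:
  fixes v :: "complex \<Rightarrow> real" and G :: "complex \<Rightarrow> complex"
  assumes V: "open V" "z \<in> V"
    and v: "\<And>w. w \<in> V \<Longrightarrow> (v has_derivative (\<lambda>h. G w \<bullet> h)) (at w)"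
    and G: "(G has_derivative D) (at z)"
    and a: "norm a = 1" and b: "norm b = 1"
  shows "D b \<bullet> a = D a \<bullet> b"
proof -
  have "\<bar>D b \<bullet> a - D a \<bullet> b\<bar> \<le> e" if "e > 0" for e
  proof -
    have e2: "e/2 > 0" using that by simp
    obtain d1 where d1: "d1 > 0" "\<And>t. 0 < t \<Longrightarrow> t < d1 \<Longrightarrow>
      \<bar>v (z + t *\<^sub>R a + t *\<^sub>R b) - v (z + t *\<^sub>R a) - v (z + t *\<^sub>R b) + v z - t\<^sup>2 * (D b \<bullet> a)\<bar> \<le> e/2 * t\<^sup>2"
      using second_difference_estimate[OF V v G a b e2] by blast
    obtain d2 where d2: "d2 > 0" "\<And>t. 0 < t \<Longrightarrow> t < d2 \<Longrightarrow>
      \<bar>v (z + t *\<^sub>R b + t *\<^sub>R a) - v (z + t *\<^sub>R b) - v (z + t *\<^sub>R a) + v z - t\<^sup>2 * (D a \<bullet> b)\<bar> \<le> e/2 * t\<^sup>2"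
      using second_difference_estimate[OF V v G b a e2] by blast
    define t where "t = min d1 d2 / 2"
    have t: "0 < t" "t < d1" "t < d2" using d1(1) d2(1) by (auto simp: t_def)
    have eq: "z + t *\<^sub>R b + t *\<^sub>R a = z + t *\<^sub>R a + t *\<^sub>R b" by simp
    have "\<bar>t\<^sup>2 * (D b \<bullet> a) - t\<^sup>2 * (D a \<bullet> b)\<bar> \<le> e/2 * t\<^sup>2 + e/2 * t\<^sup>2"
      using d1(2)[OF t(1,2)] d2(2)[OF t(1,3)] unfolding eq by linarith
    then have "\<bar>t\<^sup>2 * (D b \<bullet> a) - t\<^sup>2 * (D a \<bullet> b)\<bar> \<le> e * t\<^sup>2" by simp
    then have "t\<^sup>2 * \<bar>D b \<bullet> a - D a \<bullet> b\<bar> \<le> t\<^sup>2 * e"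
      by (simp add: abs_mult flip: right_diff_distrib) (simp add: mult.commute)
    then show ?thesis using t(1) by simp
  qed
  then have "\<bar>D b \<bullet> a - D a \<bullet> b\<bar> \<le> 0" by (rule field_le_epsilon[of _ 0, simplified])
  then show ?thesis by simp
qed

text \<open>Symmetry of the second derivative and the vanishing Laplacian are the two Cauchy-Riemann
  equations for v_x - i v_y.\<close>

lemma cnj_gradient_has_field_derivative:
  fixes v :: "complex \<Rightarrow> real" and G :: "complex \<Rightarrow> complex"
  assumes V: "open V" "z \<in> V"
    and v: "\<And>w. w \<in> V \<Longrightarrow> (v has_derivative (\<lambda>h. G w \<bullet> h)) (at w)"
    and G: "(G has_derivative D) (at z)"
    and lap: "Re (D 1) + Im (D \<i>) = 0"
  shows "((\<lambda>w. cnj (G w)) has_field_derivative cnj (D 1)) (at z)"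
proof -
  have sym: "Re (D \<i>) = Im (D 1)"
    using second_derivative_symmetric[OF V v G, of 1 \<i>] by (simp add: inner_complex_def)
  have lin: "linear D" using G has_derivative_linear by blast
  have *: "cnj (D h) = cnj (D 1) * h" for h
  proof -
    have "h = Re h *\<^sub>R 1 + Im h *\<^sub>R \<i>" by (simp add: complex_eq_iff)
    then have "D h = Re h *\<^sub>R D 1 + Im h *\<^sub>R D \<i>"
      by (metis lin linear_add linear_scale)
    moreover have "Re (D 1) = - Im (D \<i>)" using lap by simp
    ultimately show ?thesis using sym by (simp add: complex_eq_iff algebra_simps)
  qed
  then have "(\<lambda>h. cnj (D h)) = (*) (cnj (D 1))" by (intro ext *)
  moreover have "((\<lambda>w. cnj (G w)) has_derivative (\<lambda>h. cnj (D h))) (at z)"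
    using G by (rule bounded_linear.has_derivative[OF bounded_linear_cnj])
  ultimately show ?thesis unfolding has_field_derivative_def by simp
qed

section \<open>Schwarz-Pick and Harnack estimates along radii\<close>

text \<open>The disc automorphism \<open>m\<close> takes 0 to \<open>w\<close>, a Cayley map takes
  \<open>F w\<close> to 0, and Schwarz's lemma applies to the composite \<open>g\<close>. The
  factors are the derivative 1 - |w|^2 of \<open>m\<close> at 0 and the derivative 1 / (2 Re a) of
  the Cayley map at \<open>a\<close>.\<close>

lemma Schwarz_Pick_half_plane:
  assumes hol: "F holomorphic_on ball 0 1" and pos: "\<And>z. norm z < 1 \<Longrightarrow> Re (F z) > 0"
    and w: "norm w < 1"
  shows "norm (deriv F w) * (1 - (norm w)\<^sup>2) \<le> 2 * Re (F w)"
proof -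
  define m where "m z = (z + w) / (1 + cnj w * z)" for z
  have den: "1 + cnj w * z \<noteq> 0" if "norm z < 1" for z
  proof
    assume "1 + cnj w * z = 0"
    then have "norm (cnj w * z) = 1" by (metis add_eq_0_iff norm_minus_cancel norm_one)
    moreover have "norm (cnj w * z) < 1" using mult_strict_mono'[of "norm w" 1 "norm z" 1] that w by (simp add: norm_mult)
    ultimately show False by simp
  qed
  have "norm (m z) < 1" if "norm z < 1" for z
  proof -
    have "0 < (1 - (norm z)\<^sup>2) * (1 - (norm w)\<^sup>2)"
      using that w by (intro mult_pos_pos) (auto simp: abs_square_less_1)
    also have "\<dots> = (norm (1 + cnj w * z))\<^sup>2 - (norm (z + w))\<^sup>2"
      unfolding cmod_power2 by (simp add: power2_eq_square algebra_simps)
    finally have "norm (z + w) < norm (1 + cnj w * z)"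
      by (simp add: power_less_imp_less_base)
    then show ?thesis unfolding m_def using den[OF that] by (simp add: norm_divide)
  qed
  note mlt = this
  then have mim: "m \<in> ball 0 1 \<rightarrow> ball 0 1" by auto
  have holm: "m holomorphic_on ball 0 1" unfolding m_def by (intro holomorphic_intros) (auto simp: den)
  define a where "a = F w"
  have a: "Re a > 0" unfolding a_def using pos w by simp
  define g where "g z = (F (m z) - a) / (F (m z) + cnj a)" for z
  have den2: "F (m z) + cnj a \<noteq> 0" if "norm z < 1" for z
  proof -
    have "Re (F (m z) + cnj a) > 0" using pos[OF mlt[OF that]] a by simp
    then show ?thesis by (metis less_irrefl zero_complex.sel(1))
  qed
  have holFm: "(\<lambda>z. F (m z)) holomorphic_on ball 0 1"
    using holomorphic_on_compose_gen[OF holm hol] mim by (auto simp: o_def)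
  have holg: "g holomorphic_on ball 0 1" unfolding g_def by (intro holomorphic_intros holFm) (auto simp: den2)
  have g0: "g 0 = 0" by (simp add: g_def m_def a_def)
  have "norm (g z) < 1" if "norm z < 1" for z
  proof -
    have p: "Re (F (m z)) > 0" using pos[OF mlt[OF that]] .
    have "(norm (F (m z) - a))\<^sup>2 < (norm (F (m z) + cnj a))\<^sup>2"
      using mult_pos_pos[OF p a] unfolding cmod_power2 by (simp add: power2_eq_square algebra_simps)
    then have "norm (F (m z) - a) < norm (F (m z) + cnj a)"
      by (rule power_less_imp_less_base) simp
    then show ?thesis unfolding g_def norm_divide using den2[OF that] by (subst divide_less_eq_1_pos) auto
  qed
  then have dg: "norm (deriv g 0) \<le> 1" using Schwarz_Lemma(2)[OF holg g0, of 0] by simp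
  have dF: "(F has_field_derivative deriv F w) (at w)"
    using hol w by (meson holomorphic_derivI mem_ball_0 open_ball)
  have m0: "m 0 = w" by (simp add: m_def)
  have dm: "(m has_field_derivative (1 - w * cnj w)) (at 0)"
    unfolding m_def by (auto intro!: derivative_eq_intros simp: algebra_simps)
  have dFm: "((\<lambda>z. F (m z)) has_field_derivative deriv F w * (1 - w * cnj w)) (at 0)"
    using DERIV_chain2[of F "deriv F w" m 0] dF dm m0 by simp
  have aa: "a + cnj a = of_real (2 * Re a)" by (simp add: complex_eq_iff)
  then have aa0: "a + cnj a \<noteq> 0" using a by (metis of_real_eq_0_iff less_irrefl mult_eq_0_iff zero_neq_numeral)
  have "(g has_field_derivative deriv F w * (1 - w * cnj w) / (a + cnj a)) (at 0)"
    unfolding g_def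
    by (rule DERIV_cong, rule DERIV_divide[OF DERIV_diff[OF dFm DERIV_const] DERIV_add[OF dFm DERIV_const]])
      (use aa0 in \<open>auto simp: m0 a_def[symmetric] divide_simps\<close>)
  then have "deriv g 0 = deriv F w * (1 - w * cnj w) / (a + cnj a)" by (rule DERIV_imp_deriv)
  also have "\<dots> = deriv F w * of_real (1 - (norm w)\<^sup>2) / of_real (2 * Re a)"
    by (simp only: aa of_real_diff of_real_1 complex_norm_square)
  finally have eq: "deriv g 0 = deriv F w * of_real (1 - (norm w)\<^sup>2) / of_real (2 * Re a)" .
  have "norm (deriv g 0) = norm (deriv F w) * (1 - (norm w)\<^sup>2) / (2 * Re a)"
    using w a unfolding eq norm_divide norm_mult norm_of_real by (simp add: abs_square_le_1 power_le_one)
  then have "norm (deriv F w) * (1 - (norm w)\<^sup>2) = norm (deriv g 0) * (2 * Re a)"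
    using a by simp
  also have "\<dots> \<le> 1 * (2 * Re a)" using dg a by (intro mult_right_mono) auto
  finally show ?thesis by (simp add: a_def)
qed


lemma radial_derivative:
  assumes hol: "F holomorphic_on ball 0 1" and e: "norm e = 1" and x: "0 \<le> x" "x < 1"
  shows "((\<lambda>x. Re (F (x *\<^sub>R e))) has_real_derivative Re (deriv F (x *\<^sub>R e) * e)) (at x)"
proof -
  have "(F has_field_derivative deriv F (x *\<^sub>R e)) (at (x *\<^sub>R e))"
    using holomorphic_derivI[OF hol open_ball] x e by simp
  moreover have "((\<lambda>x. x *\<^sub>R e) has_vector_derivative e) (at x)"
    by (auto intro!: derivative_eq_intros)
  ultimately have "((F \<circ> (\<lambda>x. x *\<^sub>R e)) has_vector_derivative (e * deriv F (x *\<^sub>R e))) (at x)"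
    using field_vector_diff_chain_at by blast
  then have "((\<lambda>x. F (x *\<^sub>R e)) has_vector_derivative (deriv F (x *\<^sub>R e) * e)) (at x)"
    by (simp add: o_def mult.commute)
  then show ?thesis unfolding has_real_derivative_iff_has_vector_derivative
    by (rule bounded_linear.has_vector_derivative[OF bounded_linear_Re])
qed

text \<open>Schwarz-Pick bounds the logarithmic derivative along a radius by 2 / (1 - x^2), which is
  the logarithmic derivative of (1 + x) / (1 - x). Multiplication by this quotient or by its inverse
  therefore gives monotone functions.\<close>

lemma radial_Harnack:
  assumes hol: "F holomorphic_on ball 0 1" and pos: "\<And>z. norm z < 1 \<Longrightarrow> Re (F z) > 0"
    and e: "norm e = 1" and st: "0 \<le> s" "s \<le> t" "t < 1"
  shows "Re (F (s *\<^sub>R e)) * (1 + s) / (1 - s) \<le> Re (F (t *\<^sub>R e)) * (1 + t) / (1 - t)"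
    and "Re (F (t *\<^sub>R e)) * (1 - t) / (1 + t) \<le> Re (F (s *\<^sub>R e)) * (1 - s) / (1 + s)"
proof -
  define p where "p x = Re (F (x *\<^sub>R e))" for x
  define p' where "p' x = Re (deriv F (x *\<^sub>R e) * e)" for x
  have dp: "(p has_real_derivative p' x) (at x)" if "0 \<le> x" "x < 1" for x
  proof -
    show ?thesis unfolding p_def p'_def by (rule radial_derivative[OF hol e that])
  qed
  have bd: "\<bar>p' x\<bar> * (1 - x\<^sup>2) \<le> 2 * p x" if "0 \<le> x" "x < 1" for x
  proof -
    have "\<bar>p' x\<bar> \<le> norm (deriv F (x *\<^sub>R e))"
      unfolding p'_def using abs_Re_le_cmod[of "deriv F (x *\<^sub>R e) * e"] e by (simp add: norm_mult)
    then have "\<bar>p' x\<bar> * (1 - x\<^sup>2) \<le> norm (deriv F (x *\<^sub>R e)) * (1 - x\<^sup>2)"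
      using that by (intro mult_right_mono) (auto simp: power_le_one)
    also have "\<dots> \<le> 2 * p x"
      using Schwarz_Pick_half_plane[OF hol pos, of "x *\<^sub>R e"] that e by (simp add: p_def)
    finally show ?thesis .
  qed
  have "p s * ((1 + s) / (1 - s)) \<le> p t * ((1 + t) / (1 - t))"
  proof (rule DERIV_nonneg_imp_nondecreasing[OF st(2)])
    fix x assume "s \<le> x" "x \<le> t"
    then have x: "0 \<le> x" "x < 1" using st by auto
    have "((\<lambda>x. p x * ((1 + x) / (1 - x))) has_real_derivative (p' x * (1 - x\<^sup>2) + 2 * p x) / (1 - x)\<^sup>2) (at x)"
      using x by (auto intro!: derivative_eq_intros dp simp: divide_simps power2_eq_square) (simp add: algebra_simps)
    moreover have "- (p' x * (1 - x\<^sup>2)) \<le> \<bar>p' x\<bar> * (1 - x\<^sup>2)"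
      using x by (metis abs_ge_minus_self minus_mult_left mult_right_mono diff_ge_0_iff_ge power_le_one less_imp_le)
    ultimately show "\<exists>y. ((\<lambda>x. p x * ((1 + x) / (1 - x))) has_real_derivative y) (at x) \<and> 0 \<le> y"
      using bd[OF x] by (intro exI[of _ "(p' x * (1 - x\<^sup>2) + 2 * p x) / (1 - x)\<^sup>2"] conjI) auto
  qed
  then show "Re (F (s *\<^sub>R e)) * (1 + s) / (1 - s) \<le> Re (F (t *\<^sub>R e)) * (1 + t) / (1 - t)"
    by (simp add: p_def)
  have "p t * ((1 - t) / (1 + t)) \<le> p s * ((1 - s) / (1 + s))"
  proof (rule DERIV_nonpos_imp_nonincreasing[OF st(2)])
    fix x assume "s \<le> x" "x \<le> t"
    then have x: "0 \<le> x" "x < 1" using st by auto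
    have "((\<lambda>x. p x * ((1 - x) / (1 + x))) has_real_derivative (p' x * (1 - x\<^sup>2) - 2 * p x) / (1 + x)\<^sup>2) (at x)"
      using x by (auto intro!: derivative_eq_intros dp simp: divide_simps power2_eq_square) (simp add: algebra_simps)
    moreover have "p' x * (1 - x\<^sup>2) \<le> \<bar>p' x\<bar> * (1 - x\<^sup>2)"
      using x by (intro mult_right_mono) (auto simp: power_le_one)
    ultimately show "\<exists>y. ((\<lambda>x. p x * ((1 - x) / (1 + x))) has_real_derivative y) (at x) \<and> y \<le> 0"
      using bd[OF x] by (intro exI[of _ "(p' x * (1 - x\<^sup>2) - 2 * p x) / (1 + x)\<^sup>2"] conjI) (auto intro: divide_nonpos_nonneg)
  qed
  then show "Re (F (t *\<^sub>R e)) * (1 - t) / (1 + t) \<le> Re (F (s *\<^sub>R e)) * (1 - s) / (1 + s)"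
    by (simp add: p_def)
qed

section \<open>Estimates on a normalised disc that touches the boundary\<close>

text \<open>The Hopf lemma read backwards: slope at most 1 at the contact point, as encoded in
  \<open>bdry\<close>, keeps the function small inside. Harnack carries the value at
  \<open>r\<close> out to \<open>t\<close> near 1, where the factor 1 - t cancels and 1 + t tends to
  2.\<close>

lemma Hopf_upper_bound:
  assumes hol: "F holomorphic_on ball 0 1" and pos: "\<And>z. norm z < 1 \<Longrightarrow> Re (F z) > 0"
    and e: "norm e = 1"
    and bdry: "\<And>\<epsilon>. \<epsilon> > 0 \<Longrightarrow> \<exists>t0<1. \<forall>t. t0 < t \<and> t < 1 \<longrightarrow> Re (F (t *\<^sub>R e)) \<le> (1 + \<epsilon>) * (1 - t)"
    and r: "0 \<le> r" "r < 1"
  shows "Re (F (r *\<^sub>R e)) \<le> 2 * (1 - r) / (1 + r)"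
proof -
  have "Re (F (r *\<^sub>R e)) * (1 + r) / (1 - r) \<le> 2 + \<epsilon>" if eps: "\<epsilon> > 0" for \<epsilon>
  proof -
    obtain t0 where t0: "t0 < 1" "\<And>t. t0 < t \<Longrightarrow> t < 1 \<Longrightarrow> Re (F (t *\<^sub>R e)) \<le> (1 + \<epsilon>/2) * (1 - t)"
      using bdry[OF half_gt_zero[OF eps]] by blast
    obtain t where t: "max t0 r < t" "t < 1" using dense[of "max t0 r" 1] t0(1) r by auto
    have "Re (F (r *\<^sub>R e)) * (1 + r) / (1 - r) \<le> Re (F (t *\<^sub>R e)) * (1 + t) / (1 - t)"
      using radial_Harnack(1)[OF hol pos e r(1)] t by simp
    also have "\<dots> \<le> ((1 + \<epsilon>/2) * (1 - t)) * (1 + t) / (1 - t)"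
      using t0(2)[of t] t r by (intro divide_right_mono mult_right_mono) auto
    also have "\<dots> = (1 + \<epsilon>/2) * (1 + t)" using t by simp
    also have "\<dots> \<le> (1 + \<epsilon>/2) * 2" using t eps by (intro mult_left_mono) auto
    finally show ?thesis by simp
  qed
  then have "Re (F (r *\<^sub>R e)) * (1 + r) / (1 - r) \<le> 2" by (rule field_le_epsilon)
  then show ?thesis using r by (simp add: divide_simps split: if_splits)
qed

text \<open>In the direction \<open>e\<close> of steepest descent, M + Re (F' e) is nonnegative,
  harmonic and small at 0, so Harnack keeps it small up to radius \<open>r\<close>. Thus Re F falls
  at a rate close to \<open>M\<close> over the length \<open>r\<close> and is still positive at the
  end.\<close>

lemma nearly_maximal_slope_lower_bound:
  assumes hol: "F holomorphic_on ball 0 1" and pos: "\<And>z. norm z < 1 \<Longrightarrow> Re (F z) > 0"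
    and M: "\<And>z. norm z < 1 \<Longrightarrow> norm (deriv F z) \<le> M"
    and r: "0 < r" "r < 1"
  shows "M * r - 2 * (M - norm (deriv F 0)) / (1 - r) \<le> Re (F 0)"
proof -
  define b where "b = norm (deriv F 0)"
  obtain e where e: "norm e = 1" "deriv F 0 * e = - of_real b"
  proof (cases "deriv F 0 = 0")
    case True then show ?thesis using that[of 1] by (simp add: b_def)
  next
    case False
    show ?thesis
    proof (rule that[of "- cnj (deriv F 0) / of_real b"])
      show "norm (- cnj (deriv F 0) / of_real b) = 1" using False by (simp add: b_def norm_divide)
      show "deriv F 0 * (- cnj (deriv F 0) / of_real b) = - of_real b"
        using False complex_norm_square[of "deriv F 0"] unfolding b_def
        by (simp add: divide_simps power2_eq_square)
    qed
  qed
  have hol': "deriv F holomorphic_on ball 0 1" by (intro holomorphic_deriv hol) auto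
  have "M * r - 2 * (M - b) / (1 - r) \<le> Re (F 0) + \<epsilon>" if "\<epsilon> > 0" for \<epsilon>
  proof -
    \<comment> \<open>Harnack is stated for strictly positive functions, while M + Re (F' e) may
      vanish. The shift by \<open>k\<close> repairs this, and its value makes the additional error 2
      k / (1 - r) equal to \<epsilon>.\<close>
    define k where "k = \<epsilon> * (1 - r) / 2"
    have k: "k > 0" using that r by (simp add: k_def)
    define H where "H z = of_real (M + k) + deriv F z * e" for z
    have holH: "H holomorphic_on ball 0 1" unfolding H_def by (intro holomorphic_intros hol')
    have posH: "Re (H z) > 0" if "norm z < 1" for z
      using abs_Re_le_cmod[of "deriv F z * e"] M[OF that] e k by (simp add: H_def norm_mult)
    define Q where "Q = - M + 2 * (M + k - b) / (1 - r)"
    have H0: "Re (H 0) = M + k - b" using e by (simp add: H_def)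
    have slope: "Re (deriv F (x *\<^sub>R e) * e) \<le> Q" if x: "0 \<le> x" "x \<le> r" for x
    proof -
      have "Re (H (x *\<^sub>R e)) * (1 - x) / (1 + x) \<le> M + k - b"
        using radial_Harnack(2)[OF holH posH e(1), of 0 x] x r H0 by simp
      then have "Re (H (x *\<^sub>R e)) \<le> (M + k - b) * (1 + x) / (1 - x)"
        using x r by (simp add: divide_simps split: if_splits)
      also have "\<dots> \<le> (M + k - b) * 2 / (1 - r)"
        using posH[of 0] H0 x r by (intro frac_le mult_left_mono mult_nonneg_nonneg) auto
      finally show ?thesis using k by (simp add: H_def Q_def mult.commute)
    qed
    have dF: "((\<lambda>x. Re (F (x *\<^sub>R e))) has_real_derivative Re (deriv F (x *\<^sub>R e) * e)) (at x)"
      if x: "0 \<le> x" "x \<le> r" for x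
      using radial_derivative[OF hol e(1), of x] x r by simp
    obtain x where x: "0 < x" "x < r" "Re (F (r *\<^sub>R e)) - Re (F (0 *\<^sub>R e)) = (r - 0) * Re (deriv F (x *\<^sub>R e) * e)"
      using MVT2[OF r(1) dF] by auto
    have "0 < Re (F (r *\<^sub>R e))" using pos r e by simp
    also have "\<dots> = Re (F 0) + r * Re (deriv F (x *\<^sub>R e) * e)" using x(3) by simp
    also have "\<dots> \<le> Re (F 0) + r * Q" using slope[of x] x r by (intro add_left_mono mult_left_mono) auto
    also have "r * Q \<le> - (M * r) + 2 * (M + k - b) / (1 - r)"
    proof -
      have "r * (2 * (M + k - b) / (1 - r)) \<le> 1 * (2 * (M + k - b) / (1 - r))"
        using r posH[of 0] H0 by (intro mult_right_mono) auto
      then show ?thesis by (simp add: Q_def algebra_simps)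
    qed
    finally have "0 < Re (F 0) + (- (M * r) + 2 * (M + k - b) / (1 - r))" by simp
    moreover have "2 * (M + k - b) / (1 - r) = 2 * (M - b) / (1 - r) + \<epsilon>"
      using r by (simp add: k_def divide_simps) (simp add: algebra_simps)
    ultimately show ?thesis by simp
  qed
  then show ?thesis unfolding b_def by (rule field_le_epsilon)
qed

text \<open>The 4 is the bound 2 for Re (F 0), from the Hopf estimate at radius 0, times the 2 of
  Schwarz-Pick. The second claim squeezes Re (F 0) between the lower bound forced by a nearly
  maximal slope and the upper bound from the Lipschitz constant \<open>M\<close> and the contact
  point.\<close>

lemma slope_bound_at_contact:
  assumes hol: "F holomorphic_on ball 0 1" and pos: "\<And>z. norm z < 1 \<Longrightarrow> Re (F z) > 0"
    and e: "norm e = 1"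
    and bdry: "\<And>\<epsilon>. \<epsilon> > 0 \<Longrightarrow> \<exists>t0<1. \<forall>t. t0 < t \<and> t < 1 \<longrightarrow> Re (F (t *\<^sub>R e)) \<le> (1 + \<epsilon>) * (1 - t)"
  shows "norm (deriv F 0) \<le> 4"
    and "\<lbrakk>\<And>z. norm z < 1 \<Longrightarrow> norm (deriv F z) \<le> M; 0 < r; r < 1; 0 < s; s < 1\<rbrakk> \<Longrightarrow>
      M * s - 2 * (M - norm (deriv F 0)) / (1 - s) \<le> M * r + 2 * (1 - r) / (1 + r)"
proof -
  show "norm (deriv F 0) \<le> 4"
    using Hopf_upper_bound[OF hol pos e bdry, of 0] Schwarz_Pick_half_plane[OF hol pos, of 0] by simp
  assume M: "\<And>z. norm z < 1 \<Longrightarrow> norm (deriv F z) \<le> M" and r: "0 < r" "r < 1" and s: "0 < s" "s < 1"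
  have "norm (F (r *\<^sub>R e) - F 0) \<le> M * norm (r *\<^sub>R e - 0)"
  proof (rule field_differentiable_bound[of "ball 0 1" F "deriv F"])
    show "(F has_field_derivative deriv F z) (at z within ball 0 1)" if "z \<in> ball 0 1" for z
      using holomorphic_derivI[OF hol open_ball that] has_field_derivative_at_within by blast
  qed (use M r e in auto)
  then have "Re (F 0) \<le> M * r + Re (F (r *\<^sub>R e))"
    using abs_Re_le_cmod[of "F (r *\<^sub>R e) - F 0"] r e by simp
  then show "M * s - 2 * (M - norm (deriv F 0)) / (1 - s) \<le> M * r + 2 * (1 - r) / (1 + r)"
    using nearly_maximal_slope_lower_bound[OF hol pos M s] Hopf_upper_bound[OF hol pos e bdry, of r] r by simp
qed

text \<open>Stretching by \<open>R\<close> and dividing by \<open>R\<close> leaves the gradient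
  unchanged, so slope bounds pass to the unit disc without constants. \<open>F\<close> is a
  primitive of the conjugate gradient, corrected by a constant.\<close>

lemma normalized_potential:
  fixes v :: "complex \<Rightarrow> real" and G :: "complex \<Rightarrow> complex"
  assumes R: "R > 0"
    and v: "\<And>z. z \<in> ball c R \<Longrightarrow> (v has_derivative (\<lambda>h. G z \<bullet> h)) (at z)"
    and G: "(\<lambda>z. cnj (G z)) holomorphic_on ball c R"
  obtains F where "F holomorphic_on ball 0 1"
    "\<And>z. norm z < 1 \<Longrightarrow> Re (F z) = v (c + of_real R * z) / R"
    "\<And>z. norm z < 1 \<Longrightarrow> deriv F z = cnj (G (c + of_real R * z))"
proof -
  have inb: "c + of_real R * z \<in> ball c R" if "norm z < 1" for z
    using that R by (simp add: dist_norm norm_mult)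
  have "(\<lambda>z. cnj (G (c + of_real R * z))) holomorphic_on ball 0 1"
    using holomorphic_on_compose_gen[of "\<lambda>z. c + of_real R * z" "ball 0 1", OF _ G] inb
    by (force simp: o_def image_subset_iff intro!: holomorphic_intros)
  then obtain F0 where F0: "\<And>z. z \<in> ball 0 1 \<Longrightarrow> (F0 has_field_derivative cnj (G (c + of_real R * z))) (at z within ball 0 1)"
    using holomorphic_convex_primitive'[OF convex_ball open_ball] by metis
  have F0': "(F0 has_field_derivative cnj (G (c + of_real R * z))) (at z)" if "norm z < 1" for z
    using F0[of z] that by (simp add: at_within_open[of z "ball 0 1"])
  define d where "d z = Re (F0 z) - v (c + of_real R * z) / R" for z
  have "(d has_derivative (\<lambda>h. 0)) (at z within ball 0 1)" if z: "z \<in> ball 0 1" for z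
  proof -
    have z': "norm z < 1" using z by simp
    have 1: "((\<lambda>z. Re (F0 z)) has_derivative (\<lambda>h. Re (cnj (G (c + of_real R * z)) * h))) (at z)"
      using bounded_linear.has_derivative[OF bounded_linear_Re F0'[OF z', unfolded has_field_derivative_def]] .
    have "((\<lambda>z. c + of_real R * z) has_derivative (\<lambda>h. of_real R * h)) (at z)"
      by (auto intro!: derivative_eq_intros)
    from has_derivative_compose[OF this v[OF inb[OF z']]]
    have 2: "((\<lambda>z. v (c + of_real R * z)) has_derivative (\<lambda>h. G (c + of_real R * z) \<bullet> (of_real R * h))) (at z)" .
    have "(d has_derivative (\<lambda>h. Re (cnj (G (c + of_real R * z)) * h) - G (c + of_real R * z) \<bullet> (of_real R * h) / R)) (at z)"
      unfolding d_def using R by (intro has_derivative_diff 1 bounded_linear.has_derivative[OF bounded_linear_divide 2])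
    moreover have "Re (cnj w * h) - w \<bullet> (of_real R * h) / R = 0" for w h :: complex
      using R by (simp add: inner_complex_def divide_simps) (simp add: algebra_simps)
    ultimately show ?thesis by (simp add: has_derivative_at_withinI)
  qed
  then obtain k where k: "\<And>z. z \<in> ball 0 1 \<Longrightarrow> d z = k"
    using has_derivative_zero_constant[OF convex_ball, of 0 1 d] by blast
  have F': "((\<lambda>z. F0 z - of_real k) has_field_derivative cnj (G (c + of_real R * z))) (at z)" if "norm z < 1" for z
    using DERIV_diff[OF F0'[OF that] DERIV_const] by simp
  show ?thesis
  proof (rule that[of "\<lambda>z. F0 z - of_real k"])
    show "(\<lambda>z. F0 z - of_real k) holomorphic_on ball 0 1"
      unfolding holomorphic_on_def field_differentiable_def
      by (metis F' has_field_derivative_at_within mem_ball_0)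
    show "Re (F0 z - of_real k) = v (c + of_real R * z) / R" if "norm z < 1" for z
      using k[of z] that by (simp add: d_def)
    show "deriv (\<lambda>z. F0 z - of_real k) z = cnj (G (c + of_real R * z))" if "norm z < 1" for z
      using F'[OF that] by (rule DERIV_imp_deriv)
  qed
qed

section \<open>Sections of the developing map\<close>

text \<open>Continuity is relative to \<open>A\<close>, so that one notion serves open discs, closed
  discs and a convex set with a single added limit point.\<close>

definition section_on :: "'a topology \<Rightarrow> ('a \<Rightarrow> complex) \<Rightarrow> complex set \<Rightarrow> (complex \<Rightarrow> 'a) \<Rightarrow> bool" where
  "section_on X f A s \<longleftrightarrow> continuous_map (top_of_set A) X s \<and> (\<forall>z\<in>A. f (s z) = z)"

lemma section_on_subset: "section_on X f A s \<Longrightarrow> B \<subseteq> A \<Longrightarrow> section_on X f B s"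
  unfolding section_on_def by (blast intro: continuous_map_from_subtopology_mono)

lemma section_on_topspace: "section_on X f A s \<Longrightarrow> z \<in> A \<Longrightarrow> s z \<in> topspace X"
  unfolding section_on_def continuous_map_def by auto

lemma section_on_local_preimage:
  assumes "section_on X f A s" "z \<in> A" "openin X U" "s z \<in> U"
  obtains r where "r > 0" "s ` (A \<inter> ball z r) \<subseteq> U"
proof -
  have "openin (top_of_set A) {w \<in> A. s w \<in> U}"
    using assms(1,3) openin_continuous_map_preimage[of "top_of_set A" X s U] by (simp add: section_on_def)
  then obtain r where "r > 0" "ball z r \<inter> A \<subseteq> {w \<in> A. s w \<in> U}"
    using assms(2,4) by (auto simp: openin_contains_ball)
  then show ?thesis by (intro that[of r]) auto
qed

lemma chart_on_inj: "chart_on X f U \<Longrightarrow> inj_on f U"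
  using openin_subset by (fastforce simp: chart_on_def homeomorphic_map_def inf_absorb2)

lemma chart_on_openin: "chart_on X f U \<Longrightarrow> openin X U"
  by (simp add: chart_on_def)

lemma chart_on_section:
  assumes "chart_on X f U" shows "section_on X f (f ` U) (inv_into U f)"
proof -
  have U: "U \<subseteq> topspace X" using assms by (simp add: chart_on_def openin_subset)
  obtain g where g: "homeomorphic_maps (subtopology X U) (top_of_set (f ` U)) f g"
    using assms by (auto simp: chart_on_def homeomorphic_map_maps)
  have "continuous_map (top_of_set (f ` U)) (subtopology X U) g"
    using g by (simp add: homeomorphic_maps_def)
  then have "continuous_map (top_of_set (f ` U)) X g" by (rule continuous_map_into_fulltopology)
  moreover have "g z = inv_into U f z" if "z \<in> topspace (top_of_set (f ` U))" for z
    using that g U chart_on_inj[OF assms] by (auto simp: homeomorphic_maps_def)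
  ultimately have "continuous_map (top_of_set (f ` U)) X (inv_into U f)"
    using continuous_map_eq by blast
  then show ?thesis by (auto simp: section_on_def f_inv_into_f)
qed

lemma chart_on_section_eq:
  assumes "chart_on X f U" "x \<in> U" shows "inv_into U f (f x) = x"
  using assms chart_on_inj inv_into_f_f by metis

text \<open>As long as \<open>s\<close> stays in one chart it coincides with the inverse of that
  chart, by injectivity of \<open>f\<close> there; pasting these inverses gives continuity.\<close>

lemma section_on_localI:
  assumes fs: "\<And>z. z \<in> A \<Longrightarrow> f (s z) = z"
    and loc: "\<And>z. z \<in> A \<Longrightarrow> \<exists>U r. chart_on X f U \<and> r > 0 \<and> s ` (A \<inter> ball z r) \<subseteq> U"
  shows "section_on X f A s"
proof -
  obtain U r where U: "\<And>z. z \<in> A \<Longrightarrow> chart_on X f (U z)" "\<And>z. z \<in> A \<Longrightarrow> r z > 0"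
    "\<And>z. z \<in> A \<Longrightarrow> s ` (A \<inter> ball z (r z)) \<subseteq> U z"
    using loc by metis
  have s_eq: "s w = inv_into (U z) f w" if "z \<in> A" "w \<in> A" "w \<in> ball z (r z)" for z w
  proof -
    have "s w \<in> U z" using U(3)[OF that(1)] that by blast
    from chart_on_section_eq[OF U(1)[OF that(1)] this] show ?thesis using fs[OF that(2)] by simp
  qed
  have "continuous_map (top_of_set A) X s"
  proof (rule pasting_lemma[where I = A and T = "\<lambda>z. A \<inter> ball z (r z)" and f = "\<lambda>z. inv_into (U z) f"])
    show "openin (top_of_set A) (A \<inter> ball z (r z))" for z by (simp add: openin_open_Int)
    show "continuous_map (subtopology (top_of_set A) (A \<inter> ball z (r z))) X (inv_into (U z) f)" if "z \<in> A" for z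
    proof -
      have "A \<inter> ball z (r z) \<subseteq> f ` U z"
        using U(3)[OF that] fs by (metis IntD1 image_subset_iff image_eqI subsetI)
      then show ?thesis
        using chart_on_section[OF U(1)[OF that]] by (auto simp: section_on_def subtopology_subtopology Int_absorb1 intro: continuous_map_from_subtopology_mono)
    qed
    show "inv_into (U z) f x = inv_into (U w) f x"
      if "z \<in> A" "w \<in> A" "x \<in> topspace (top_of_set A) \<inter> (A \<inter> ball z (r z)) \<inter> (A \<inter> ball w (r w))" for z w x
      using s_eq[of z x] s_eq[of w x] that by auto
    show "\<exists>j. j \<in> A \<and> x \<in> A \<inter> ball j (r j) \<and> s x = inv_into (U j) f x"
      if "x \<in> topspace (top_of_set A)" for x
      using s_eq[of x x] U(2) that by (auto intro!: exI[of _ x])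
  qed
  then show ?thesis using fs by (simp add: section_on_def)
qed

lemma glue_sections:
  assumes op: "\<And>i. i \<in> I \<Longrightarrow> open (B i)" and sec: "\<And>i. i \<in> I \<Longrightarrow> section_on X f (B i) (\<sigma> i)"
    and agree: "\<And>i j z. \<lbrakk>i \<in> I; j \<in> I; z \<in> B i; z \<in> B j\<rbrakk> \<Longrightarrow> \<sigma> i z = \<sigma> j z"
  shows "\<exists>s. section_on X f (\<Union>i\<in>I. B i) s \<and> (\<forall>i\<in>I. \<forall>z\<in>B i. s z = \<sigma> i z)"
proof -
  define s where "s z = \<sigma> (SOME i. i \<in> I \<and> z \<in> B i) z" for z
  have s: "s z = \<sigma> i z" if "i \<in> I" "z \<in> B i" for i z
  proof -
    have "(SOME i. i \<in> I \<and> z \<in> B i) \<in> I \<and> z \<in> B (SOME i. i \<in> I \<and> z \<in> B i)"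
      using that by (intro someI[of "\<lambda>i. i \<in> I \<and> z \<in> B i" i]) auto
    then show ?thesis unfolding s_def using agree that by blast
  qed
  have "continuous_map (top_of_set (\<Union>i\<in>I. B i)) X s"
  proof (rule pasting_lemma[where I = I and T = B and f = \<sigma>])
    show "openin (top_of_set (\<Union>i\<in>I. B i)) (B i)" if "i \<in> I" for i
      using that op by (intro open_openin_trans open_UN ballI) auto
    show "continuous_map (subtopology (top_of_set (\<Union>i\<in>I. B i)) (B i)) X (\<sigma> i)" if "i \<in> I" for i
    proof -
      have "(\<Union>i\<in>I. B i) \<inter> B i = B i" using that by auto
      then show ?thesis using sec[OF that] by (simp add: section_on_def subtopology_subtopology)
    qed
    show "\<sigma> i x = \<sigma> j x" if "i \<in> I" "j \<in> I" "x \<in> topspace (top_of_set (\<Union>i\<in>I. B i)) \<inter> B i \<inter> B j" for i j x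
      using agree[OF that(1,2)] that(3) by blast
    show "\<exists>j. j \<in> I \<and> x \<in> B j \<and> s x = \<sigma> j x" if "x \<in> topspace (top_of_set (\<Union>i\<in>I. B i))" for x
    proof -
      from that obtain i where "i \<in> I" "x \<in> B i" by auto
      with s show ?thesis by blast
    qed
  qed
  moreover have "f (s z) = z" if "z \<in> (\<Union>i\<in>I. B i)" for z
  proof -
    from that obtain i where i: "i \<in> I" "z \<in> B i" by auto
    then show ?thesis using s[OF i] sec[OF i(1)] by (simp add: section_on_def)
  qed
  ultimately have "section_on X f (\<Union>i\<in>I. B i) s" unfolding section_on_def by blast
  then show ?thesis using s by blast
qed

section \<open>Path length and the intrinsic distance\<close>

text \<open>The partition 0, x, 1 already contributes this chord. Hence every point of a curve, not
  only its start, projects to within the length of the curve from the projected end point.\<close>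

lemma curve_length_ge:
  assumes "0 \<le> x" "x \<le> 1" shows "ereal (norm (g 1 - g x)) \<le> curve_length g"
proof -
  define t where "t = (\<lambda>i::nat. if i = 0 then 0 else if i = 1 then x else 1)"
  have "(2::nat, t) \<in> {(n, t). t 0 = (0::real) \<and> t n = 1 \<and> (\<forall>i<n. t i \<le> t (Suc i))}"
    using assms by (auto simp: t_def less_Suc_eq numeral_2_eq_2)
  then have "ereal (\<Sum>i<2. norm (g (t (Suc i)) - g (t i))) \<le> curve_length g"
    unfolding curve_length_def by (rule SUP_upper2) simp
  moreover have "norm (g 1 - g x) \<le> (\<Sum>i<2. norm (g (t (Suc i)) - g (t i)))"
    by (simp add: numeral_2_eq_2 t_def)
  ultimately show ?thesis by (meson ereal_less_eq(3) order_trans)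
qed

lemma curve_length_segment_le:
  assumes g: "\<And>x. 0 \<le> x \<Longrightarrow> x \<le> 1 \<Longrightarrow> g x = z + x *\<^sub>R (w - z)"
  shows "curve_length g \<le> ereal (dist z w)"
  unfolding curve_length_def
proof (rule SUP_least, clarsimp)
  fix n :: nat and t :: "nat \<Rightarrow> real"
  assume t: "t 0 = 0" "t n = 1" "\<forall>i<n. t i \<le> t (Suc i)"
  \<comment> \<open>Partitions are constrained only through consecutive points; monotonicity puts
    all of them into [0, 1], where \<open>g\<close> is known to be affine.\<close>
  have mono: "t i \<le> t j" if "i \<le> j" "j \<le> n" for i j
    using that by (induction j rule: dec_induct) (use t(3) in \<open>auto intro: order_trans\<close>)
  have "norm (g (t (Suc i)) - g (t i)) = (t (Suc i) - t i) * dist z w" if "i < n" for i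
  proof -
    have "0 \<le> t i" "t i \<le> t (Suc i)" "t (Suc i) \<le> 1"
      using mono[of 0 i] mono[of "Suc i" n] t that by auto
    moreover from this have "g (t (Suc i)) - g (t i) = (t (Suc i) - t i) *\<^sub>R (w - z)"
      by (simp add: g scaleR_diff_left)
    ultimately show ?thesis by (simp add: dist_norm norm_minus_commute)
  qed
  then have "(\<Sum>i<n. norm (g (t (Suc i)) - g (t i))) = (\<Sum>i<n. t (Suc i) - t i) * dist z w"
    by (simp add: sum_distrib_right)
  also have "(\<Sum>i<n. t (Suc i) - t i) = 1" using t by (simp add: sum_lessThan_telescope)
  finally show "(\<Sum>i<n. norm (g (t (Suc i)) - g (t i))) \<le> dist z w" by simp
qed

lemma idist_ge: "ereal (dist (f p) (f q)) \<le> idist X f p q"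
  unfolding idist_def
proof (rule INF_greatest)
  fix \<gamma> :: "real \<Rightarrow> 'a" assume "\<gamma> \<in> {\<gamma>. continuous_map (top_of_set {0..1}) X \<gamma> \<and> \<gamma> 0 = p \<and> \<gamma> 1 = q}"
  then show "ereal (dist (f p) (f q)) \<le> curve_length (f \<circ> \<gamma>)"
    using curve_length_ge[of 0 "f \<circ> \<gamma>"] by (auto simp: dist_norm norm_minus_commute)
qed

text \<open>The segment stays in the convex set, and the length of its lift is measured through
  \<open>f\<close>. Together with \<open>idist_ge\<close>, sections over convex sets preserve
  distances.\<close>

lemma idist_section_le:
  assumes s: "section_on X f A s" and "convex A" "z \<in> A" "w \<in> A"
  shows "idist X f (s z) (s w) \<le> ereal (dist z w)"
proof -
  define l where "l x = z + x *\<^sub>R (w - z)" for x :: real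
  have l: "l x \<in> A" if "0 \<le> x" "x \<le> 1" for x
  proof -
    have "l x = (1 - x) *\<^sub>R z + x *\<^sub>R w" by (simp add: l_def algebra_simps)
    then show ?thesis using assms that by (simp add: convexD)
  qed
  have "continuous_map (top_of_set {0..1}) (top_of_set A) l"
    using l by (auto simp: continuous_map_in_subtopology l_def intro!: continuous_intros)
  then have "continuous_map (top_of_set {0..1}) X (s \<circ> l)"
    using s unfolding section_on_def by (blast intro: continuous_map_compose)
  then have "idist X f (s z) (s w) \<le> curve_length (f \<circ> (s \<circ> l))"
    unfolding idist_def by (intro INF_lower) (simp add: l_def)
  also have "\<dots> \<le> ereal (dist z w)"
    using s l by (intro curve_length_segment_le) (auto simp: section_on_def l_def)
  finally show ?thesis .
qed

section \<open>Lifting through charts and completeness\<close>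

locale flat_surface =
  fixes X :: "'a topology" and f :: "'a \<Rightarrow> complex"
  assumes immersed: "immersed_domain X f"
begin

lemma Hausdorff: "Hausdorff_space X"
  using immersed by (simp add: immersed_domain_def)

text \<open>The local model in the form that \<open>chart_absorbs\<close> consumes: the chart image
  is relatively closed in an open set, since the supergraph of a continuous function is
  closed.\<close>

lemma local_chart:
  assumes "p \<in> topspace X"
  obtains U W S where "p \<in> U" "chart_on X f U" "open W" "closed S" "f ` U = W \<inter> S"
proof -
  from assms immersed have "local_model X f p" by (simp add: immersed_domain_def)
  then obtain U W where UW: "p \<in> U" "chart_on X f U" "open W" and alt: "f ` U = W \<or>
       (\<exists>a c h. norm a = 1 \<and> smooth_real h \<and> f ` U = W \<inter> {z. Im (a * (z - c)) \<ge> h (Re (a * (z - c)))})"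
    unfolding local_model_def by blast
  from alt show ?thesis
  proof
    assume "f ` U = W" then show ?thesis using that[OF UW, of UNIV] by simp
  next
    assume "\<exists>a c h. norm a = 1 \<and> smooth_real h \<and> f ` U = W \<inter> {z. Im (a * (z - c)) \<ge> h (Re (a * (z - c)))}"
    then obtain a c h where h: "smooth_real h" and eq: "f ` U = W \<inter> {z. Im (a * (z - c)) \<ge> h (Re (a * (z - c)))}"
      by blast
    have "h differentiable (at x)" for x using h[unfolded smooth_real_def, rule_format, of 0 x] by simp
    then have "continuous_on UNIV h" by (simp add: continuous_at_imp_continuous_on differentiable_imp_continuous_within)
    then have "continuous_on UNIV (\<lambda>z. h (Re (a * (z - c))))"
      by (rule continuous_on_compose2) (auto intro!: continuous_intros)
    then have "closed {z. h (Re (a * (z - c))) \<le> Im (a * (z - c))}"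
      by (intro closed_Collect_le continuous_intros)
    then show ?thesis using that[OF UW _ eq] by simp
  qed
qed

lemma continuous_developing_map: "continuous_map X euclidean f"
proof (rule pasting_lemma[where I = "{U. chart_on X f U}" and T = id and f = "\<lambda>_. f"])
  show "openin X (id U)" if "U \<in> {U. chart_on X f U}" for U using that by (simp add: chart_on_def)
  show "continuous_map (subtopology X (id U)) euclidean f" if "U \<in> {U. chart_on X f U}" for U
    using that homeomorphic_imp_continuous_map continuous_map_into_fulltopology by (fastforce simp: chart_on_def)
  show "\<exists>U. U \<in> {U. chart_on X f U} \<and> x \<in> id U \<and> f x = f x" if "x \<in> topspace X" for x
    using local_chart[OF that] by auto
qed auto

text \<open>
  The image of a chart is relatively closed in \<open>W\<close>, so a connected family lying over \<open>W\<close> cannot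
  leave the chart. This does the work of path lifting and of comparing \<open>idist\<close> with the topology.
\<close>

lemma chart_absorbs:
  fixes \<sigma> :: "'b::topological_space \<Rightarrow> 'a"
  assumes U: "chart_on X f U" "closed S" "f ` U = W \<inter> S"
    and T: "connected T" "continuous_map (top_of_set T) X \<sigma>" "\<And>t. t \<in> T \<Longrightarrow> f (\<sigma> t) \<in> W"
    and t0: "t0 \<in> T" "\<sigma> t0 \<in> U"
  shows "\<sigma> ` T \<subseteq> U"
proof -
  define T0 where "T0 = {t \<in> T. \<sigma> t \<in> U}"
  have op: "openin (top_of_set T) T0"
    using openin_continuous_map_preimage[OF T(2) chart_on_openin[OF U(1)]] by (simp add: T0_def)
  have cf: "continuous_map (top_of_set T) euclidean (f \<circ> \<sigma>)"
    using T(2) continuous_developing_map by (rule continuous_map_compose)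
  \<comment> \<open>On \<open>C\<close> the chart inverse applies, so the family can be compared
    with its copy inside \<open>U\<close>. The two agree exactly on \<open>T0\<close>, which is
    closed because \<open>X\<close> is Hausdorff.\<close>
  define C where "C = {t \<in> T. f (\<sigma> t) \<in> S}"
  have C: "closedin (top_of_set T) C"
    using closedin_continuous_map_preimage[OF cf, of S] U(2) by (simp add: C_def)
  have CT: "C \<subseteq> T" by (auto simp: C_def)
  have "(f \<circ> \<sigma>) ` C \<subseteq> f ` U" using T(3) U(3) by (auto simp: C_def)
  moreover have "continuous_map (top_of_set C) euclidean (f \<circ> \<sigma>)"
    using cf CT by (rule continuous_map_from_subtopology_mono)
  ultimately have "continuous_map (top_of_set C) (top_of_set (f ` U)) (f \<circ> \<sigma>)"
    unfolding continuous_map_in_subtopology by auto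
  then have "continuous_map (top_of_set C) X (inv_into U f \<circ> (f \<circ> \<sigma>))"
    using chart_on_section[OF U(1)] unfolding section_on_def by (blast intro: continuous_map_compose)
  moreover have "continuous_map (top_of_set C) X \<sigma>"
    using T(2) CT by (rule continuous_map_from_subtopology_mono)
  ultimately have "closedin (top_of_set C) {t \<in> topspace (top_of_set C). (inv_into U f \<circ> (f \<circ> \<sigma>)) t = \<sigma> t}"
    using Hausdorff by (intro closedin_continuous_maps_eq)
  moreover have "{t \<in> topspace (top_of_set C). (inv_into U f \<circ> (f \<circ> \<sigma>)) t = \<sigma> t} = T0"
  proof -
    have "t \<in> T0" if "t \<in> C" "inv_into U f (f (\<sigma> t)) = \<sigma> t" for t
    proof -
      have "f (\<sigma> t) \<in> f ` U" using that T(3) U(3) by (auto simp: C_def)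
      then have "inv_into U f (f (\<sigma> t)) \<in> U" by (rule inv_into_into)
      then show ?thesis using that by (simp add: T0_def C_def)
    qed
    moreover have "t \<in> C" "inv_into U f (f (\<sigma> t)) = \<sigma> t" if "t \<in> T0" for t
      using that U chart_on_section_eq[OF U(1)] by (auto simp: T0_def C_def)
    ultimately show ?thesis by auto
  qed
  ultimately have "closedin (top_of_set C) T0" by simp
  then have "closedin (top_of_set T) T0" using C closedin_trans by blast
  then have "T0 = T" using T(1) op t0 unfolding connected_clopen T0_def by blast
  then show ?thesis by (auto simp: T0_def)
qed

text \<open>The set of agreement is closed because \<open>X\<close> is Hausdorff, and open because
  \<open>f\<close> is injective on charts.\<close>

lemma section_unique:
  assumes s: "section_on X f A s" and s': "section_on X f A s'" and "connected A"
    and a: "a \<in> A" "s a = s' a" and z: "z \<in> A"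
  shows "s z = s' z"
proof -
  define E where "E = {z \<in> A. s z = s' z}"
  have "closedin (top_of_set A) {z \<in> topspace (top_of_set A). s z = s' z}"
    using Hausdorff s s' by (intro closedin_continuous_maps_eq) (auto simp: section_on_def)
  then have "closedin (top_of_set A) E" by (simp add: E_def)
  moreover have "openin (top_of_set A) E"
    unfolding openin_contains_ball
  proof (intro conjI ballI)
    fix w assume "w \<in> E"
    then have w: "w \<in> A" "s w = s' w" by (auto simp: E_def)
    obtain U where U: "s w \<in> U" "chart_on X f U" using local_chart section_on_topspace[OF s w(1)] by metis
    obtain r where r: "r > 0" "s ` (A \<inter> ball w r) \<subseteq> U"
      using section_on_local_preimage[OF s w(1) chart_on_openin[OF U(2)] U(1)] .
    obtain r' where r': "r' > 0" "s' ` (A \<inter> ball w r') \<subseteq> U"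
      using section_on_local_preimage[OF s' w(1) chart_on_openin[OF U(2)]] U(1) w(2) by auto
    have "s y = s' y" if "y \<in> A" "y \<in> ball w (min r r')" for y
    proof -
      have "s y \<in> U" "s' y \<in> U" "f (s y) = f (s' y)" using that r r' s s' by (auto simp: section_on_def)
      then show ?thesis using chart_on_inj[OF U(2)] by (simp add: inj_on_def)
    qed
    then show "\<exists>e>0. ball w e \<inter> A \<subseteq> E" using r(1) r'(1) by (intro exI[of _ "min r r'"]) (auto simp: E_def)
  qed (auto simp: E_def)
  ultimately have "E = A" using \<open>connected A\<close> a unfolding connected_clopen E_def by blast
  then show ?thesis using z by (auto simp: E_def)
qed

text \<open>A curve of length below \<open>r\<close> that ends at \<open>q\<close> projects into the
  ball about \<open>f q\<close>; \<open>chart_absorbs\<close>, started at the end point, then keeps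
  all of it in the chart.\<close>

lemma idist_small_imp_in_chart:
  assumes U: "q \<in> U" "chart_on X f U" "closed S" "f ` U = W \<inter> S" and r: "ball (f q) r \<subseteq> W"
    and less: "idist X f x q < ereal r"
  shows "x \<in> U"
proof -
  obtain \<gamma> where \<gamma>: "continuous_map (top_of_set {0..1}) X \<gamma>" "\<gamma> 0 = x" "\<gamma> 1 = q" "curve_length (f \<circ> \<gamma>) < ereal r"
    using less unfolding idist_def INF_less_iff by auto
  have "f (\<gamma> t) \<in> W" if "t \<in> {0..1}" for t
  proof -
    have "ereal (norm ((f \<circ> \<gamma>) 1 - (f \<circ> \<gamma>) t)) < ereal r"
      using order.strict_trans1[OF curve_length_ge[of t "f \<circ> \<gamma>"] \<gamma>(4)] that by simp
    then show ?thesis using r \<gamma>(3) by (auto simp: dist_norm)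
  qed
  then have "\<gamma> ` {0..1} \<subseteq> U"
    using chart_absorbs[OF U(2-4) _ \<gamma>(1), of 1] U(1) \<gamma>(3) by auto
  then show ?thesis using \<gamma>(2) by auto
qed


text \<open>A sequence in \<open>A\<close> tending to \<open>z\<close> lifts to a Cauchy sequence,
  and completeness provides \<open>q\<close>. The last conclusion takes the place of convergence:
  one term lies in the chart about \<open>q\<close>, and the convex, hence connected, part of
  \<open>A\<close> near \<open>z\<close> follows it.\<close>

lemma section_limit_point:
  assumes s: "section_on X f A s" and A: "convex A" and z: "z \<in> closure A"
  obtains q where "q \<in> topspace X" "f q = z"
    "\<And>U W S r. \<lbrakk>q \<in> U; chart_on X f U; closed S; f ` U = W \<inter> S; r > 0; ball z r \<subseteq> W\<rbrakk> \<Longrightarrow> s ` (A \<inter> ball z r) \<subseteq> U"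
proof -
  obtain y where y: "\<And>n. y n \<in> A" "y \<longlonglongrightarrow> z" using z unfolding closure_sequential by blast
  have "Cauchy y" using y(2) by (rule LIMSEQ_imp_Cauchy)
  have ex: "\<exists>N. \<forall>m\<ge>N. \<forall>n\<ge>N. idist X f (s (y m)) (s (y n)) < ereal e" if e: "e > 0" for e
  proof -
    obtain N where N: "\<And>m n. m \<ge> N \<Longrightarrow> n \<ge> N \<Longrightarrow> dist (y m) (y n) < e"
      using \<open>Cauchy y\<close> e unfolding Cauchy_def by blast
    have "idist X f (s (y m)) (s (y n)) < ereal e" if "m \<ge> N" "n \<ge> N" for m n
      using idist_section_le[OF s A y(1)[of m] y(1)[of n]] N[OF that] by (simp add: order.strict_trans1)
    then show ?thesis by blast
  qed
  have tops: "s (y n) \<in> topspace X" for n using section_on_topspace[OF s y(1)] .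
  have comp: "idist_complete X f" using immersed by (simp add: immersed_domain_def)
  have "\<exists>q\<in>topspace X. (\<lambda>n. idist X f (s (y n)) q) \<longlonglongrightarrow> 0"
    using comp[unfolded idist_complete_def, THEN spec, of "\<lambda>n. s (y n)"] tops ex by simp
  then obtain q where q: "q \<in> topspace X" "(\<lambda>n. idist X f (s (y n)) q) \<longlonglongrightarrow> 0" by blast
  have small: "\<forall>\<^sub>F n in sequentially. idist X f (s (y n)) q < ereal e" if "e > 0" for e
    using q(2) that by (auto intro: order_tendstoD)
  have fy: "f (s (y n)) = y n" for n using s y(1) by (simp add: section_on_def)
  have "y \<longlonglongrightarrow> f q"
  proof (rule tendstoI)
    fix e :: real assume "e > 0"
    from small[OF this] show "\<forall>\<^sub>F n in sequentially. dist (y n) (f q) < e"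
    proof (rule eventually_mono)
      fix n assume "idist X f (s (y n)) q < ereal e"
      then have "ereal (dist (y n) (f q)) < ereal e"
        using idist_ge[of f "s (y n)" q X] fy by (metis order.strict_trans1)
      then show "dist (y n) (f q) < e" by simp
    qed
  qed
  then have fq: "f q = z" using y(2) LIMSEQ_unique by blast
  show ?thesis
  proof (rule that[OF q(1) fq])
    fix U W S and r :: real
    assume U: "q \<in> U" "chart_on X f U" "closed S" "f ` U = W \<inter> S" and r: "r > 0" "ball z r \<subseteq> W"
    have "\<forall>\<^sub>F n in sequentially. idist X f (s (y n)) q < ereal r \<and> dist (y n) z < r"
      using small[OF r(1)] tendstoD[OF y(2) r(1)] by (rule eventually_conj)
    then obtain n where n: "idist X f (s (y n)) q < ereal r" "dist (y n) z < r"
      using eventually_happens'[OF sequentially_bot] by blast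
    have "s (y n) \<in> U" using idist_small_imp_in_chart[OF U _ n(1)] r(2) fq by simp
    moreover have "connected (A \<inter> ball z r)" by (intro convex_connected convex_Int A convex_ball)
    moreover have "continuous_map (top_of_set (A \<inter> ball z r)) X s"
      using section_on_subset[OF s, of "A \<inter> ball z r"] by (simp add: section_on_def)
    moreover have "f (s t) \<in> W" if "t \<in> A \<inter> ball z r" for t
      using that s r(2) by (auto simp: section_on_def)
    moreover have "y n \<in> A \<inter> ball z r" using y(1) n(2) by (simp add: dist_commute)
    ultimately show "s ` (A \<inter> ball z r) \<subseteq> U"
      using chart_absorbs[OF U(2-4)] by metis
  qed
qed

lemma section_extends_to_closure:
  assumes s: "section_on X f A s" and A: "convex A"
  obtains s' where "section_on X f (closure A) s'" "\<And>z. z \<in> A \<Longrightarrow> s' z = s z"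
proof -
  define P where "P z q \<longleftrightarrow> q \<in> topspace X \<and> f q = z \<and>
    (\<forall>U W S r. q \<in> U \<longrightarrow> chart_on X f U \<longrightarrow> closed S \<longrightarrow> f ` U = W \<inter> S \<longrightarrow> r > 0 \<longrightarrow> ball z r \<subseteq> W \<longrightarrow> s ` (A \<inter> ball z r) \<subseteq> U)" for z q
  have "\<exists>q. P z q" if "z \<in> closure A" for z
    using section_limit_point[OF s A that] unfolding P_def by metis
  then obtain s' where s': "\<And>z. z \<in> closure A \<Longrightarrow> P z (s' z)" by metis
  have fs': "f (s' z) = z" if "z \<in> closure A" for z using s'[OF that] by (simp add: P_def)
  have ch: "\<exists>U W S r. s' z \<in> U \<and> chart_on X f U \<and> closed S \<and> f ` U = W \<inter> S \<and> r > 0 \<and> ball z r \<subseteq> W \<and> s ` (A \<inter> ball z r) \<subseteq> U"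
    if z: "z \<in> closure A" for z
  proof -
    have "s' z \<in> topspace X" using s'[OF z] by (simp add: P_def)
    then obtain U W S where U: "s' z \<in> U" "chart_on X f U" "open W" "closed S" "f ` U = W \<inter> S"
      using local_chart by metis
    then have "z \<in> W" using fs'[OF z] by (metis IntD1 image_eqI)
    then obtain r where r: "r > 0" "ball z r \<subseteq> W" using U(3) open_contains_ball by blast
    have "s ` (A \<inter> ball z r) \<subseteq> U"
      using s'[OF z, unfolded P_def, THEN conjunct2, THEN conjunct2, rule_format, OF U(1,2,4,5) r] .
    then show ?thesis using U(1,2,4,5) r by (intro exI conjI)
  qed
  have eq: "s' z = s z" if z: "z \<in> A" for z
  proof -
    have zc: "z \<in> closure A" using z closure_subset by blast
    obtain U r where U: "s' z \<in> U" "chart_on X f U" "r > 0" "s ` (A \<inter> ball z r) \<subseteq> U"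
      using ch[OF zc] by metis
    then have "s z \<in> U" using z by auto
    moreover have "f (s' z) = f (s z)" using fs'[OF zc] s z by (simp add: section_on_def)
    ultimately show ?thesis using chart_on_inj[OF U(2)] U(1) by (simp add: inj_on_def)
  qed
  \<comment> \<open>Limit points are added one at a time, because the continuity proof on the whole
    closure needs \<open>s'\<close> to be continuous already on a connected set that joins a limit
    point to \<open>A\<close>.\<close>
  have insert_sec: "section_on X f (insert z A) s'" if z: "z \<in> closure A" for z
  proof (rule section_on_localI)
    fix w assume w: "w \<in> insert z A"
    then have wc: "w \<in> closure A" using z closure_subset by blast
    show "f (s' w) = w" by (rule fs'[OF wc])
    show "\<exists>U r. chart_on X f U \<and> r > 0 \<and> s' ` (insert z A \<inter> ball w r) \<subseteq> U"
    proof (cases "w = z")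
      case True
      obtain U r where U: "s' z \<in> U" "chart_on X f U" "r > 0" "s ` (A \<inter> ball z r) \<subseteq> U"
        using ch[OF z] by metis
      then have "s' ` (insert z A \<inter> ball w r) \<subseteq> U" using True eq by auto
      then show ?thesis using U by blast
    next
      case False
      then have wA: "w \<in> A" using w by simp
      obtain U where U: "s w \<in> U" "chart_on X f U" using local_chart section_on_topspace[OF s wA] by metis
      obtain r where r: "r > 0" "s ` (A \<inter> ball w r) \<subseteq> U"
        using section_on_local_preimage[OF s wA chart_on_openin[OF U(2)] U(1)] .
      have "s' ` (insert z A \<inter> ball w (min r (dist w z))) \<subseteq> U" using r(2) eq by auto
      then show ?thesis using U(2) r(1) False by (intro exI[of _ U] exI[of _ "min r (dist w z)"]) auto
    qed
  qed
  have "section_on X f (closure A) s'"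
  proof (rule section_on_localI)
    fix z assume z: "z \<in> closure A"
    show "f (s' z) = z" by (rule fs'[OF z])
    obtain U W S r where U: "s' z \<in> U" "chart_on X f U" "closed S" "f ` U = W \<inter> S" "r > 0" "ball z r \<subseteq> W" "s ` (A \<inter> ball z r) \<subseteq> U"
      using ch[OF z] by metis
    have "s' w \<in> U" if w: "w \<in> closure A" "w \<in> ball z r" for w
    proof -
      \<comment> \<open>\<open>T\<close> lies between a connected set and its closure, hence is
        connected, and \<open>chart_absorbs\<close> carries membership in \<open>U\<close> from a
        point of \<open>A\<close> to \<open>w\<close>.\<close>
      define T where "T = insert w (A \<inter> ball z r)"
      have wT: "w \<in> closure (A \<inter> ball z r)"
        using w open_Int_closure_subset[OF open_ball, of z r A] by (auto simp: Int_commute)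
      have ne: "A \<inter> ball z r \<noteq> {}" using wT by auto
      then obtain a where a: "a \<in> A" "a \<in> ball z r" by blast
      have conn: "connected T"
        using connected_intermediate_closure[of "A \<inter> ball z r" T] wT closure_subset[of "A \<inter> ball z r"]
        by (auto simp: T_def A convex_Int convex_connected)
      have "section_on X f T s'"
        using section_on_subset[OF insert_sec[OF w(1)], of T] by (auto simp: T_def)
      then have cont: "continuous_map (top_of_set T) X s'" and fT: "\<And>t. t \<in> T \<Longrightarrow> f (s' t) = t"
        by (auto simp: section_on_def)
      have "s' ` T \<subseteq> U"
      proof (rule chart_absorbs[OF U(2-4) conn cont])
        show "f (s' t) \<in> W" if "t \<in> T" for t
          using fT[OF that] that w U(6) by (auto simp: T_def)
        show "a \<in> T" using a by (simp add: T_def)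
        show "s' a \<in> U" using U(7) a eq by auto
      qed
      then show ?thesis by (auto simp: T_def)
    qed
    then have "s' ` (closure A \<inter> ball z r) \<subseteq> U" by auto
    then show "\<exists>U r. chart_on X f U \<and> r > 0 \<and> s' ` (closure A \<inter> ball z r) \<subseteq> U"
      using U by blast
  qed
  then show ?thesis using that eq by blast
qed

section \<open>Maximal lifted discs\<close>

lemma interior_pts_chart:
  assumes "p \<in> interior_pts X f"
  obtains U where "p \<in> U" "chart_on X f U" "open (f ` U)" "U \<subseteq> interior_pts X f"
proof -
  obtain U where U: "p \<in> U" "chart_on X f U" "open (f ` U)"
    using assms by (auto simp: interior_pts_def interior_pt_def)
  then have "U \<subseteq> interior_pts X f"
    using openin_subset[OF chart_on_openin[OF U(2)]] by (auto simp: interior_pts_def interior_pt_def)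
  then show ?thesis using that U by blast
qed

lemma bdry_iff: "p \<in> bdry X f \<longleftrightarrow> p \<in> topspace X \<and> p \<notin> interior_pts X f"
  by (auto simp: bdry_def interior_pts_def)

text \<open>Values in the interior make \<open>u\<close> harmonic on the disc; the prescribed value
  at the centre makes the lift unique.\<close>

definition lifts_ball :: "'a \<Rightarrow> real \<Rightarrow> (complex \<Rightarrow> 'a) \<Rightarrow> bool" where
  "lifts_ball p r s \<longleftrightarrow> section_on X f (ball (f p) r) s \<and> s (f p) = p \<and> s ` ball (f p) r \<subseteq> interior_pts X f"

text \<open>Chart inverses extend \<open>s\<close> around each point of the closed disc. They agree
  on overlaps and glue, and by compactness the domain of the result contains a uniform neighbourhood
  of the disc.\<close>

lemma interior_section_extends_beyond_cball:
  assumes s: "section_on X f (cball c R) s" and R: "R > 0"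
    and int: "s ` cball c R \<subseteq> interior_pts X f"
  obtains R' s' where "R' > R" "section_on X f (ball c R') s'" "s' c = s c" "s' ` ball c R' \<subseteq> interior_pts X f"
proof -
  have "\<exists>U r. chart_on X f U \<and> U \<subseteq> interior_pts X f \<and> r > 0 \<and> ball z r \<subseteq> f ` U \<and> s ` (cball c R \<inter> ball z r) \<subseteq> U"
    if z: "z \<in> cball c R" for z
  proof -
    obtain U where U: "s z \<in> U" "chart_on X f U" "open (f ` U)" "U \<subseteq> interior_pts X f"
      using interior_pts_chart int z by (metis image_subset_iff)
    obtain r1 where r1: "r1 > 0" "s ` (cball c R \<inter> ball z r1) \<subseteq> U"
      using section_on_local_preimage[OF s z chart_on_openin[OF U(2)] U(1)] .
    have "z \<in> f ` U" using s z U(1) by (metis image_eqI section_on_def)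
    then obtain r2 where r2: "r2 > 0" "ball z r2 \<subseteq> f ` U" using U(3) open_contains_ball by blast
    show ?thesis using U r1 r2 by (intro exI[of _ U] exI[of _ "min r1 r2"]) auto
  qed
  then obtain U r where U: "\<And>z. z \<in> cball c R \<Longrightarrow> chart_on X f (U z)" "\<And>z. z \<in> cball c R \<Longrightarrow> U z \<subseteq> interior_pts X f"
    "\<And>z. z \<in> cball c R \<Longrightarrow> r z > 0" "\<And>z. z \<in> cball c R \<Longrightarrow> ball z (r z) \<subseteq> f ` U z"
    "\<And>z. z \<in> cball c R \<Longrightarrow> s ` (cball c R \<inter> ball z (r z)) \<subseteq> U z"
    by metis
  have sec: "section_on X f (ball z (r z)) (inv_into (U z) f)" if "z \<in> cball c R" for z
    using section_on_subset[OF chart_on_section[OF U(1)[OF that]] U(4)[OF that]] .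
  have s_eq: "inv_into (U z) f y = s y" if "z \<in> cball c R" "y \<in> cball c R" "y \<in> ball z (r z)" for z y
  proof -
    have "s y \<in> U z" using U(5)[OF that(1)] that by blast
    from chart_on_section_eq[OF U(1)[OF that(1)] this] show ?thesis using s that(2) by (simp add: section_on_def)
  qed
  have agree: "inv_into (U z) f y = inv_into (U w) f y"
    if zw: "z \<in> cball c R" "w \<in> cball c R" and y: "y \<in> ball z (r z)" "y \<in> ball w (r w)" for z w y
  proof -
    define B where "B = ball z (r z) \<inter> ball w (r w)"
    \<comment> \<open>Two intersecting balls meet on the segment between their centres, which lies in the convex disc.\<close>
    define l where "l = r z / (r z + r w)"
    define m where "m = (1 - l) *\<^sub>R z + l *\<^sub>R w"
    have pos: "r z > 0" "r w > 0" using U(3) zw by auto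
    have l: "0 \<le> l" "l \<le> 1" using pos by (auto simp: l_def)
    have d: "dist z w < r z + r w" using y dist_triangle[of z w y] by (simp add: dist_commute)
    have "dist z m = l * dist z w"
    proof -
      have "z - m = l *\<^sub>R (z - w)" by (simp add: m_def algebra_simps)
      then show ?thesis using l by (simp add: dist_norm)
    qed
    also have "\<dots> < r z" using d pos by (simp add: l_def divide_simps mult.commute)
    finally have m1: "m \<in> ball z (r z)" by simp
    have "dist w m = (1 - l) * dist z w"
    proof -
      have "w - m = (1 - l) *\<^sub>R (w - z)" by (simp add: m_def algebra_simps)
      then show ?thesis using l by (simp add: dist_norm norm_minus_commute)
    qed
    also have "1 - l = r w / (r z + r w)" using pos by (simp add: l_def divide_simps)
    also have "r w / (r z + r w) * dist z w < r w" using d pos by (simp add: divide_simps mult.commute)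
    finally have m2: "m \<in> ball w (r w)" by simp
    have mc: "m \<in> cball c R" unfolding m_def using l by (intro convexD[OF convex_cball zw]) auto
    show ?thesis
    proof (rule section_unique)
      show "section_on X f B (inv_into (U z) f)" using section_on_subset[OF sec[OF zw(1)]] by (simp add: B_def)
      show "section_on X f B (inv_into (U w) f)" using section_on_subset[OF sec[OF zw(2)]] by (simp add: B_def)
      show "connected B" by (simp add: B_def convex_connected convex_Int)
      show "m \<in> B" using m1 m2 by (simp add: B_def)
      show "inv_into (U z) f m = inv_into (U w) f m" using s_eq zw mc m1 m2 by simp
      show "y \<in> B" using y by (simp add: B_def)
    qed
  qed
  obtain s' where s': "section_on X f (\<Union>z\<in>cball c R. ball z (r z)) s'"
    "\<And>z y. z \<in> cball c R \<Longrightarrow> y \<in> ball z (r z) \<Longrightarrow> s' y = inv_into (U z) f y"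
    using glue_sections[of "cball c R" "\<lambda>z. ball z (r z)" X f "\<lambda>z. inv_into (U z) f", OF open_ball sec agree] by blast
  have "cball c R \<subseteq> (\<Union>z\<in>cball c R. ball z (r z))" using U(3) by force
  moreover have "open (\<Union>z\<in>cball c R. ball z (r z))" by blast
  ultimately obtain e where e: "e > 0" "(\<Union>x\<in>cball c R. ball x e) \<subseteq> (\<Union>z\<in>cball c R. ball z (r z))"
    using compact_subset_open_imp_ball_epsilon_subset[OF compact_cball] by metis
  have "ball c (R + e) \<subseteq> (\<Union>x\<in>cball c R. ball x e)"
  proof
    fix w assume w: "w \<in> ball c (R + e)"
    show "w \<in> (\<Union>x\<in>cball c R. ball x e)"
    proof (cases "dist c w \<le> R")
      case True then show ?thesis using e(1) by (intro UN_I[of w]) auto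
    next
      case False
      \<comment> \<open>The radial projection of \<open>w\<close> to the circle of radius
        \<open>R\<close>; its distance to \<open>w\<close> is less than \<open>e\<close>.\<close>
      define x where "x = c + (R / dist c w) *\<^sub>R (w - c)"
      have cw: "c \<noteq> w" using False R by auto
      have "dist c x = R" using cw R by (simp add: x_def dist_norm norm_minus_commute)
      moreover have "w - x = (1 - R / dist c w) *\<^sub>R (w - c)" by (simp add: x_def algebra_simps)
      then have "dist x w = \<bar>1 - R / dist c w\<bar> * dist c w" by (metis dist_norm dist_commute norm_scaleR)
      then have "dist x w = dist c w - R" using False R by (simp add: divide_simps abs_if split: if_splits)
      ultimately show ?thesis using w by (intro UN_I[of x]) auto
    qed
  qed
  then have sub: "ball c (R + e) \<subseteq> (\<Union>z\<in>cball c R. ball z (r z))" using e(2) by blast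
  show ?thesis
  proof (rule that[of "R + e" s'])
    show "R + e > R" using e by simp
    show "section_on X f (ball c (R + e)) s'" using section_on_subset[OF s'(1) sub] .
    show "s' c = s c" using s'(2)[of c c] s_eq[of c c] U(3)[of c] R by simp
    show "s' ` ball c (R + e) \<subseteq> interior_pts X f"
    proof (rule image_subsetI)
      fix w assume "w \<in> ball c (R + e)"
      then obtain z where z: "z \<in> cball c R" "w \<in> ball z (r z)" using sub by blast
      then have "s' w \<in> U z" using s'(2)[OF z] U(4)[OF z(1)] by (metis inv_into_into subsetD)
      then show "s' w \<in> interior_pts X f" using U(2)[OF z(1)] by blast
    qed
  qed
qed

text \<open>A bounded supremum of liftable radii is attained, because lifts with the same centre
  agree and glue. A closed lift without boundary contact would extend further, against the choice of
  the supremum.\<close>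

lemma maximal_lifted_ball:
  assumes p: "p \<in> interior_pts X f"
  shows "(\<forall>r>0. \<exists>s. lifts_ball p r s) \<or>
    (\<exists>R>0. \<exists>s. section_on X f (cball (f p) R) s \<and> lifts_ball p R s \<and> (\<exists>z\<in>sphere (f p) R. s z \<in> bdry X f))"
proof (rule disjCI)
  define c where "c = f p"
  define I where "I = {r. r > 0 \<and> (\<exists>s. lifts_ball p r s)}"
  assume "\<not> (\<exists>R>0. \<exists>s. section_on X f (cball (f p) R) s \<and> lifts_ball p R s \<and> (\<exists>z\<in>sphere (f p) R. s z \<in> bdry X f))"
  then have no: "False" if "R > 0" "section_on X f (cball c R) s" "lifts_ball p R s" "z \<in> sphere c R" "s z \<in> bdry X f" for R s z
    using that unfolding c_def by blast
  have "\<forall>r\<in>I. \<exists>s. lifts_ball p r s" by (simp add: I_def)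
  from bchoice[OF this] obtain \<sigma> where "\<forall>r\<in>I. lifts_ball p r (\<sigma> r)" by blast
  then have \<sigma>: "\<And>r. r \<in> I \<Longrightarrow> lifts_ball p r (\<sigma> r)" by blast
  have sec: "section_on X f (ball c r) (\<sigma> r)" if "r \<in> I" for r
    using \<sigma>[OF that] by (simp add: lifts_ball_def c_def)
  have agree: "\<sigma> r z = \<sigma> t z" if "r \<in> I" "t \<in> I" "z \<in> ball c r" "z \<in> ball c t" for r t z
  proof (rule section_unique[where A = "ball c (min r t)"])
    show "section_on X f (ball c (min r t)) (\<sigma> r)" "section_on X f (ball c (min r t)) (\<sigma> t)"
      by (rule section_on_subset[OF sec], use that in auto)+
    show "\<sigma> r c = \<sigma> t c" using \<sigma> that by (simp add: lifts_ball_def c_def)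
    show "c \<in> ball c (min r t)" using that by (simp add: I_def)
  qed (use that in auto)
  \<comment> \<open>\<open>R\<close> itself need not belong to \<open>I\<close>. This serves both
    for the supremum and for an arbitrary radius below a member of \<open>I\<close>.\<close>
  have glued: "\<exists>s. lifts_ball p R s" if R: "R > 0" "ball c R \<subseteq> (\<Union>r\<in>I. ball c r)" for R
  proof -
    obtain s where s: "section_on X f (\<Union>r\<in>I. ball c r) s" "\<And>r z. r \<in> I \<Longrightarrow> z \<in> ball c r \<Longrightarrow> s z = \<sigma> r z"
      using glue_sections[of I "ball c" X f \<sigma>, OF open_ball sec agree] by blast
    have val: "\<exists>r\<in>I. z \<in> ball c r \<and> s z = \<sigma> r z" if "z \<in> ball c R" for z
      using that R(2) s(2) by blast
    have "s ` ball c R \<subseteq> interior_pts X f"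
    proof (rule image_subsetI)
      fix z assume "z \<in> ball c R"
      then obtain r where r: "r \<in> I" "z \<in> ball c r" "s z = \<sigma> r z" using val by blast
      then show "s z \<in> interior_pts X f" using \<sigma>[OF r(1)] by (auto simp: lifts_ball_def c_def)
    qed
    moreover have "s c = p"
    proof -
      obtain r where r: "r \<in> I" "s c = \<sigma> r c" using val[of c] R(1) by auto
      then show ?thesis using \<sigma>[OF r(1)] by (auto simp: lifts_ball_def c_def)
    qed
    ultimately show ?thesis using section_on_subset[OF s(1) R(2)] by (auto simp: lifts_ball_def c_def)
  qed
  have "\<exists>r\<in>I. r > R" if "R > 0" for R
  proof (rule ccontr)
    assume "\<not> (\<exists>r\<in>I. r > R)"
    then have bdd: "bdd_above I" by (meson bdd_above.I not_le)
    obtain U where U: "p \<in> U" "chart_on X f U" "open (f ` U)" "U \<subseteq> interior_pts X f"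
      using interior_pts_chart[OF p] .
    obtain r0 where r0: "r0 > 0" "ball c r0 \<subseteq> f ` U" using U(1,3) open_contains_ball unfolding c_def by blast
    have "lifts_ball p r0 (inv_into U f)"
      unfolding lifts_ball_def
    proof (intro conjI)
      show "section_on X f (ball (f p) r0) (inv_into U f)"
        using section_on_subset[OF chart_on_section[OF U(2)] r0(2)] by (simp add: c_def)
      show "inv_into U f (f p) = p" using chart_on_section_eq[OF U(2,1)] .
      show "inv_into U f ` ball (f p) r0 \<subseteq> interior_pts X f"
        using r0(2) U(4) inv_into_into[of _ f U] by (fastforce simp: c_def)
    qed
    then have r0I: "r0 \<in> I" using r0(1) by (auto simp: I_def)
    define R0 where "R0 = Sup I"
    have R0: "R0 > 0" using cSup_upper[OF r0I bdd] r0(1) by (simp add: R0_def)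
    have "ball c R0 \<subseteq> (\<Union>r\<in>I. ball c r)"
    proof
      fix z assume "z \<in> ball c R0"
      then have "dist c z < Sup I" by (simp add: R0_def)
      then obtain r where "r \<in> I" "dist c z < r" using less_cSupD[of I "dist c z"] r0I by auto
      then show "z \<in> (\<Union>r\<in>I. ball c r)" by auto
    qed
    then obtain s where s: "lifts_ball p R0 s" using glued[OF R0] by blast
    obtain s1 where s1: "section_on X f (closure (ball c R0)) s1" "\<And>z. z \<in> ball c R0 \<Longrightarrow> s1 z = s z"
      using section_extends_to_closure[of "ball c R0" s] s by (auto simp: lifts_ball_def c_def)
    have s1c: "section_on X f (cball c R0) s1" using s1(1) R0 by simp
    have l1: "lifts_ball p R0 s1"
      using s s1(2) section_on_subset[OF s1c ball_subset_cball] R0 by (auto simp: lifts_ball_def c_def)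
    have "s1 z \<in> interior_pts X f" if "z \<in> cball c R0" for z
    proof (cases "z \<in> sphere c R0")
      case True
      then show ?thesis using no[OF R0 s1c l1 True] section_on_topspace[OF s1c that] by (auto simp: bdry_iff)
    next
      case False
      then have "z \<in> ball c R0" using that by auto
      then show ?thesis using l1 by (auto simp: lifts_ball_def c_def)
    qed
    then obtain R' s' where s': "R' > R0" "section_on X f (ball c R') s'" "s' c = s1 c" "s' ` ball c R' \<subseteq> interior_pts X f"
      using interior_section_extends_beyond_cball[OF s1c R0] by blast
    then have "lifts_ball p R' s'" using l1 by (simp add: lifts_ball_def c_def)
    then have "R' \<in> I" using s'(1) R0 by (auto simp: I_def)
    then show False using cSup_upper[OF _ bdd] s'(1) by (fastforce simp: R0_def)
  qed
  then have "\<exists>s. lifts_ball p R s" if R: "R > 0" for R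
  proof -
    obtain r where r: "r \<in> I" "r > R" using \<open>\<And>R. R > 0 \<Longrightarrow> \<exists>r\<in>I. r > R\<close> R by blast
    have "ball c R \<subseteq> ball c r" using r(2) by (intro subset_ball) simp
    also have "\<dots> \<subseteq> (\<Union>r\<in>I. ball c r)" using r(1) by (rule UN_upper)
    finally show ?thesis by (rule glued[OF R])
  qed
  then show "\<forall>r>0. \<exists>s. lifts_ball p r s" by blast
qed

end

section \<open>The gradient bound\<close>

locale overdetermined_solution = flat_surface +
  fixes u :: "'a \<Rightarrow> real" and gu :: "'a \<Rightarrow> complex"
  assumes assoc: "associated_function X f u gu"
begin

lemma u_continuous: "continuous_map X euclideanreal u"
  and gu_continuous: "continuous_map X euclidean gu"
  and u_pos: "p \<in> interior_pts X f \<Longrightarrow> u p > 0"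
  and u_bdry: "p \<in> bdry X f \<Longrightarrow> u p = 0"
  and gu_bdry: "p \<in> bdry X f \<Longrightarrow> norm (gu p) = 1"
  using assoc by (auto simp: associated_function_def)

lemma u_nonneg: "p \<in> topspace X \<Longrightarrow> u p \<ge> 0"
  using u_pos[of p] u_bdry[of p] bdry_iff[of p] by fastforce

lemma continuous_on_section_u: "section_on X f A s \<Longrightarrow> continuous_on A (\<lambda>z. u (s z))"
  and continuous_on_section_gu: "section_on X f A s \<Longrightarrow> continuous_on A (\<lambda>z. gu (s z))"
  using continuous_map_compose[OF _ u_continuous] continuous_map_compose[OF _ gu_continuous]
  by (fastforce simp: section_on_def o_def)+

lemma section_agrees_with_chart:
  assumes s: "section_on X f B s" and B: "open B" "z \<in> B" and U: "chart_on X f U" "s z \<in> U"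
  obtains r where "r > 0" "ball z r \<subseteq> B" "\<And>w. w \<in> ball z r \<Longrightarrow> s w \<in> U \<and> inv_into U f w = s w"
proof -
  obtain r1 where r1: "r1 > 0" "s ` (B \<inter> ball z r1) \<subseteq> U"
    using section_on_local_preimage[OF s B(2) chart_on_openin[OF U(1)] U(2)] .
  obtain r2 where r2: "r2 > 0" "ball z r2 \<subseteq> B" using B open_contains_ball by blast
  show ?thesis
  proof (rule that[of "min r1 r2"])
    show "s w \<in> U \<and> inv_into U f w = s w" if "w \<in> ball z (min r1 r2)" for w
    proof -
      have w: "w \<in> B" "w \<in> ball z r1" using that r2 by auto
      then have "s w \<in> U" using r1(2) by blast
      then show ?thesis using chart_on_section_eq[OF U(1), of "s w"] s w(1) by (simp add: section_on_def)
    qed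
  qed (use r1 r2 in auto)
qed

text \<open>The derivative is given through some chart about the point, not through
  \<open>s\<close>; near \<open>z\<close> the two inverse branches of \<open>f\<close>
  coincide.\<close>

lemma section_gradient:
  assumes s: "section_on X f B s" and B: "open B" "z \<in> B" and int: "s ` B \<subseteq> interior_pts X f"
  shows "((\<lambda>w. u (s w)) has_derivative (\<lambda>h. gu (s z) \<bullet> h)) (at z)"
proof -
  have "s z \<in> interior_pts X f" using int B by auto
  then obtain U where U: "s z \<in> U" "chart_on X f U"
    "((u \<circ> inv_into U f) has_derivative (\<lambda>w. gu (s z) \<bullet> w)) (at (f (s z)))"
    using assoc unfolding associated_function_def by blast
  have fz: "f (s z) = z" using s B by (simp add: section_on_def)
  obtain r where r: "r > 0" "\<And>w. w \<in> ball z r \<Longrightarrow> inv_into U f w = s w"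
    using section_agrees_with_chart[OF s B U(2,1)] by metis
  show ?thesis
    by (rule has_derivative_transform_within_open[OF U(3)[unfolded fz] open_ball[of z r]]) (use r in auto)
qed

text \<open>Harmonicity supplies some gradient \<open>G\<close> in a chart; uniqueness of
  derivatives identifies it with \<open>gu\<close> along \<open>s\<close>.\<close>

lemma section_gradient_holomorphic:
  assumes s: "section_on X f B s" and B: "open B" and int: "s ` B \<subseteq> interior_pts X f"
  shows "(\<lambda>z. cnj (gu (s z))) holomorphic_on B"
proof -
  have "\<exists>d. ((\<lambda>w. cnj (gu (s w))) has_field_derivative d) (at z)" if z: "z \<in> B" for z
  proof -
    have "s z \<in> interior_pts X f" using int z by auto
    then obtain U where U: "s z \<in> U" "chart_on X f U" "open (f ` U)" "harmonic_on (f ` U) (u \<circ> inv_into U f)"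
      using assoc unfolding associated_function_def by blast
    have fz: "f (s z) = z" using s z by (simp add: section_on_def)
    then have zU: "z \<in> f ` U" using U(1) by (metis image_eqI)
    obtain G DG where G:
      "\<And>w. w \<in> f ` U \<Longrightarrow> ((u \<circ> inv_into U f) has_derivative (\<lambda>h. G w \<bullet> h)) (at w)"
      "\<And>w. w \<in> f ` U \<Longrightarrow> (G has_derivative DG w) (at w)"
      "\<And>w. w \<in> f ` U \<Longrightarrow> Re (DG w 1) + Im (DG w \<i>) = 0"
      using U(4) unfolding harmonic_on_def by blast
    obtain r where r: "r > 0" "ball z r \<subseteq> B" "\<And>w. w \<in> ball z r \<Longrightarrow> s w \<in> U \<and> inv_into U f w = s w"
      using section_agrees_with_chart[OF s B z U(2,1)] by metis
    have eq: "cnj (G w) = cnj (gu (s w))" if w: "w \<in> ball z r" for w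
    proof -
      have wB: "w \<in> B" using w r(2) by blast
      then have "w \<in> f ` U" using r(3)[OF w] s by (metis image_eqI section_on_def)
      from G(1)[OF this] have "((\<lambda>w. u (s w)) has_derivative (\<lambda>h. G w \<bullet> h)) (at w)"
        by (rule has_derivative_transform_within_open[OF _ open_ball[of z r] w]) (use r(3) in auto)
      then have "(\<lambda>h. G w \<bullet> h) = (\<lambda>h. gu (s w) \<bullet> h)"
        using section_gradient[OF s B wB int] by (rule has_derivative_unique)
      then have "(G w - gu (s w)) \<bullet> (G w - gu (s w)) = 0"
        by (simp add: inner_diff_left fun_eq_iff)
      then show ?thesis by simp
    qed
    have "((\<lambda>w. cnj (G w)) has_field_derivative cnj (DG z 1)) (at z)"
      using cnj_gradient_has_field_derivative[OF U(3) zU G(1) G(2)[OF zU] G(3)[OF zU]] .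
    then have "((\<lambda>w. cnj (gu (s w))) has_field_derivative cnj (DG z 1)) (at z)"
      by (rule has_field_derivative_transform_within_open[OF _ open_ball[of z r]]) (use r(1) eq in auto)
    then show ?thesis by blast
  qed
  then show ?thesis using B by (simp add: holomorphic_on_open)
qed

lemma lifted_ball_potential:
  assumes R: "R > 0" and s: "lifts_ball p R s"
  obtains F where "F holomorphic_on ball 0 1" "\<And>z. norm z < 1 \<Longrightarrow> Re (F z) > 0"
    "\<And>z. norm z < 1 \<Longrightarrow> Re (F z) = u (s (f p + of_real R * z)) / R"
    "\<And>z. norm z < 1 \<Longrightarrow> deriv F z = cnj (gu (s (f p + of_real R * z)))"
    "\<And>z. norm z < 1 \<Longrightarrow> s (f p + of_real R * z) \<in> interior_pts X f"
proof -
  have s': "section_on X f (ball (f p) R) s" "s ` ball (f p) R \<subseteq> interior_pts X f"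
    using s by (auto simp: lifts_ball_def)
  obtain F where F: "F holomorphic_on ball 0 1"
    "\<And>z. norm z < 1 \<Longrightarrow> Re (F z) = u (s (f p + of_real R * z)) / R"
    "\<And>z. norm z < 1 \<Longrightarrow> deriv F z = cnj (gu (s (f p + of_real R * z)))"
    using normalized_potential[OF R section_gradient[OF s'(1) open_ball _ s'(2)] section_gradient_holomorphic[OF s'(1) open_ball s'(2)]]
    by metis
  have int: "s (f p + of_real R * z) \<in> interior_pts X f" if "norm z < 1" for z
    using s'(2) that R by (auto simp: image_subset_iff dist_norm norm_mult)
  have "Re (F z) > 0" if "norm z < 1" for z
    using F(2)[OF that] u_pos[OF int[OF that]] R by simp
  then show ?thesis using that F int by blast
qed

section \<open>From contact discs to the bound 1\<close>

text \<open>Liouville's theorem in quantitative form: Schwarz-Pick at the centre bounds the gradient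
  norm by 2 u / r for every radius r.\<close>

lemma gradient_zero_if_plane_lifts:
  assumes "\<forall>r>0. \<exists>s. lifts_ball p r s"
  shows "gu p = 0"
proof -
  have le: "norm (gu p) * r \<le> 2 * u p" if r: "r > 0" for r
  proof -
    obtain s where s: "lifts_ball p r s" using assms r by blast
    obtain F where F: "F holomorphic_on ball 0 1" "\<And>z. norm z < 1 \<Longrightarrow> Re (F z) > 0"
      "\<And>z. norm z < 1 \<Longrightarrow> Re (F z) = u (s (f p + of_real r * z)) / r"
      "\<And>z. norm z < 1 \<Longrightarrow> deriv F z = cnj (gu (s (f p + of_real r * z)))"
      using lifted_ball_potential[OF r s] by metis
    have "s (f p) = p" using s by (simp add: lifts_ball_def)
    then show ?thesis
      using Schwarz_Pick_half_plane[OF F(1,2), of 0] F(3)[of 0] F(4)[of 0] r by (simp add: field_simps)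
  qed
  show ?thesis
  proof (rule ccontr)
    assume "gu p \<noteq> 0"
    then have n: "norm (gu p) > 0" by simp
    have u0: "2 * u p \<ge> 0" using le[of 1] n by linarith
    have "norm (gu p) * ((2 * u p + 1) / norm (gu p)) \<le> 2 * u p"
      using n u0 by (intro le divide_pos_pos) auto
    then show False using n by simp
  qed
qed

text \<open>The gradient is continuous along the closed radius and has norm 1 at the contact point,
  so the slope nearby is below 1 + \<epsilon>. As \<open>u\<close> vanishes at the end, the mean
  value theorem bounds it.\<close>

lemma contact_slope_condition:
  assumes R: "R > 0" and s: "section_on X f (cball (f p) R) s" "lifts_ball p R s"
    and z: "z \<in> sphere (f p) R" "s z \<in> bdry X f" and eps: "\<epsilon> > 0"
  defines "e \<equiv> (z - f p) / of_real R"
  shows "\<exists>t0<1. \<forall>t. t0 < t \<and> t < 1 \<longrightarrow> u (s (f p + of_real R * (t *\<^sub>R e))) / R \<le> (1 + \<epsilon>) * (1 - t)"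
proof -
  define l where "l t = f p + of_real R * (t *\<^sub>R e)" for t :: real
  have e: "norm e = 1" using z R by (simp add: e_def norm_divide dist_norm norm_minus_commute)
  have dl: "dist (f p) (l t) = \<bar>t\<bar> * R" for t using e R by (simp add: l_def dist_norm norm_mult)
  have lz: "l 1 = z" using R by (simp add: l_def e_def)
  have lc: "l t \<in> cball (f p) R" if "0 \<le> t" "t \<le> 1" for t
    using dl[of t] that R by (simp add: mult_left_le_one_le)
  have lb: "l t \<in> ball (f p) R" if "0 \<le> t" "t < 1" for t
    using dl[of t] that R by simp
  have contl: "continuous_on {0..1} l" unfolding l_def by (intro continuous_intros)
  have contu: "continuous_on {0..1} (\<lambda>t. u (s (l t)))"
    by (rule continuous_on_compose2[OF continuous_on_section_u[OF s(1)] contl]) (use lc in auto)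
  have contg: "continuous_on {0..1} (\<lambda>t. norm (gu (s (l t))))"
    by (intro continuous_on_norm continuous_on_compose2[OF continuous_on_section_gu[OF s(1)] contl]) (use lc in auto)
  have "norm (gu (s (l 1))) = 1" using lz gu_bdry[OF z(2)] by simp
  then obtain d where d: "d > 0" "\<And>t. t \<in> {0..1} \<Longrightarrow> dist t 1 < d \<Longrightarrow> dist (norm (gu (s (l t)))) 1 < \<epsilon>"
    using contg eps unfolding continuous_on_iff by (metis atLeastAtMost_iff order_refl zero_le_one)
  have "u (s (l t)) / R \<le> (1 + \<epsilon>) * (1 - t)" if t: "max 0 (1 - d) < t" "t < 1" for t
  proof -
    have der: "((\<lambda>t. u (s (l t))) has_derivative (\<lambda>h. h * (gu (s (l x)) \<bullet> (of_real R * e)))) (at x)" if x: "t < x" "x < 1" for x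
    proof -
      have "(l has_derivative (\<lambda>h. of_real R * (h *\<^sub>R e))) (at x)"
        unfolding l_def by (auto intro!: derivative_eq_intros)
      moreover have "((\<lambda>w. u (s w)) has_derivative (\<lambda>h. gu (s (l x)) \<bullet> h)) (at (l x))"
        using section_gradient[of "ball (f p) R" s] s(2) lb[of x] x t by (auto simp: lifts_ball_def)
      ultimately have "((\<lambda>t. u (s (l t))) has_derivative (\<lambda>h. gu (s (l x)) \<bullet> (of_real R * (h *\<^sub>R e)))) (at x)"
        by (rule has_derivative_compose)
      then show ?thesis by (simp add: inner_scaleR_right)
    qed
    have "continuous_on {t..1} (\<lambda>t. u (s (l t)))" using continuous_on_subset[OF contu] t by auto
    from mvt[OF t(2) this der] obtain x where x: "t < x" "x < 1"
      "u (s (l 1)) - u (s (l t)) = (1 - t) * (gu (s (l x)) \<bullet> (of_real R * e))" by blast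
    have "\<bar>gu (s (l x)) \<bullet> (of_real R * e)\<bar> \<le> norm (gu (s (l x))) * norm (of_real R * e)"
      by (rule Cauchy_Schwarz_ineq2)
    also have "\<dots> \<le> (1 + \<epsilon>) * R"
    proof -
      have "norm (gu (s (l x))) < 1 + \<epsilon>" using d(2)[of x] x t by (auto simp: dist_real_def)
      then show ?thesis using e R by (simp add: norm_mult)
    qed
    finally have "- (gu (s (l x)) \<bullet> (of_real R * e)) \<le> (1 + \<epsilon>) * R" by linarith
    then have "(1 - t) * - (gu (s (l x)) \<bullet> (of_real R * e)) \<le> (1 - t) * ((1 + \<epsilon>) * R)"
      using t by (intro mult_left_mono) auto
    then have "u (s (l t)) \<le> (1 - t) * ((1 + \<epsilon>) * R)"
      using x(3) lz u_bdry[OF z(2)] by simp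
    then show ?thesis using R by (simp add: divide_le_eq mult_ac)
  qed
  then show ?thesis using d(1) by (intro exI[of _ "max 0 (1 - d)"]) (auto simp: l_def)
qed

lemma contact_estimate:
  assumes R: "R > 0" and s: "section_on X f (cball (f p) R) s" "lifts_ball p R s"
    and z: "z \<in> sphere (f p) R" "s z \<in> bdry X f"
  shows "norm (gu p) \<le> 4"
    and "\<lbrakk>\<And>q. q \<in> interior_pts X f \<Longrightarrow> norm (gu q) \<le> M; 0 < r; r < 1; 0 < t; t < 1\<rbrakk> \<Longrightarrow>
      M * t - 2 * (M - norm (gu p)) / (1 - t) \<le> M * r + 2 * (1 - r) / (1 + r)"
proof -
  obtain F where F: "F holomorphic_on ball 0 1" "\<And>z. norm z < 1 \<Longrightarrow> Re (F z) > 0"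
    "\<And>z. norm z < 1 \<Longrightarrow> Re (F z) = u (s (f p + of_real R * z)) / R"
    "\<And>z. norm z < 1 \<Longrightarrow> deriv F z = cnj (gu (s (f p + of_real R * z)))"
    "\<And>z. norm z < 1 \<Longrightarrow> s (f p + of_real R * z) \<in> interior_pts X f"
    using lifted_ball_potential[OF R s(2)] by metis
  define e where "e = (z - f p) / of_real R"
  have e: "norm e = 1" using z R by (simp add: e_def norm_divide dist_norm norm_minus_commute)
  have sp: "s (f p) = p" using s(2) by (simp add: lifts_ball_def)
  have dF0: "norm (deriv F 0) = norm (gu p)" using F(4)[of 0] sp by simp
  have slope: "\<exists>t0<1. \<forall>t. t0 < t \<and> t < 1 \<longrightarrow> Re (F (t *\<^sub>R e)) \<le> (1 + \<epsilon>) * (1 - t)" if "\<epsilon> > 0" for \<epsilon>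
  proof -
    obtain t0 where t0: "t0 < 1" "\<And>t. t0 < t \<Longrightarrow> t < 1 \<Longrightarrow> u (s (f p + of_real R * (t *\<^sub>R e))) / R \<le> (1 + \<epsilon>) * (1 - t)"
      using contact_slope_condition[OF R s z \<open>\<epsilon> > 0\<close>] unfolding e_def by blast
    have "Re (F (t *\<^sub>R e)) \<le> (1 + \<epsilon>) * (1 - t)" if t: "max 0 t0 < t" "t < 1" for t
      using F(3)[of "t *\<^sub>R e"] t0(2)[of t] t e by simp
    then show ?thesis using t0(1) by (intro exI[of _ "max 0 t0"]) auto
  qed
  show "norm (gu p) \<le> 4" using slope_bound_at_contact(1)[OF F(1,2) e slope] dF0 by simp
  assume M: "\<And>q. q \<in> interior_pts X f \<Longrightarrow> norm (gu q) \<le> M" and rt: "0 < r" "r < 1" "0 < t" "t < 1"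
  have "norm (deriv F w) \<le> M" if "norm w < 1" for w
    using F(4)[OF that] M[OF F(5)[OF that]] by simp
  from slope_bound_at_contact(2)[OF F(1,2) e slope this rt]
  show "M * t - 2 * (M - norm (gu p)) / (1 - t) \<le> M * r + 2 * (1 - r) / (1 + r)"
    unfolding dF0 .
qed

text \<open>Makes the supremum of the gradient norms finite, so that nearly maximal points can be
  chosen.\<close>

lemma gradient_le_4:
  assumes "p \<in> interior_pts X f" shows "norm (gu p) \<le> 4"
  using maximal_lifted_ball[OF assms]
proof
  assume "\<forall>r>0. \<exists>s. lifts_ball p r s"
  then show ?thesis using gradient_zero_if_plane_lifts by simp
next
  assume "\<exists>R>0. \<exists>s. section_on X f (cball (f p) R) s \<and> lifts_ball p R s \<and> (\<exists>z\<in>sphere (f p) R. s z \<in> bdry X f)"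
  then show ?thesis using contact_estimate(1) by blast
qed

lemma gradient_le_1:
  assumes p0: "p0 \<in> interior_pts X f" shows "norm (gu p0) \<le> 1"
proof (rule ccontr)
  assume "\<not> norm (gu p0) \<le> 1"
  define N where "N = (\<lambda>p. norm (gu p)) ` interior_pts X f"
  define M where "M = Sup N"
  have bdd: "bdd_above N" using gradient_le_4 by (auto simp: N_def bdd_above_def)
  have ne: "N \<noteq> {}" using p0 by (auto simp: N_def)
  have M: "norm (gu q) \<le> M" if "q \<in> interior_pts X f" for q
    unfolding M_def using bdd that by (intro cSup_upper) (auto simp: N_def)
  have M1: "M > 1" using M[OF p0] \<open>\<not> norm (gu p0) \<le> 1\<close> by simp
  have key: "M * t - 2 * \<delta> / (1 - t) \<le> M * r + 2 * (1 - r) / (1 + r)"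
    if \<delta>: "0 < \<delta>" "\<delta> < 1" and rt: "0 < r" "r < 1" "0 < t" "t < 1" for \<delta> r t
  proof -
    have "M - \<delta> < Sup N" using \<delta> by (simp add: M_def)
    then obtain x where "x \<in> N" "M - \<delta> < x" using less_cSupD[OF ne] by blast
    then obtain p where p: "p \<in> interior_pts X f" "M - \<delta> < norm (gu p)" by (auto simp: N_def)
    \<comment> \<open>M > 1 and \<delta> < 1 exclude a vanishing gradient, so not every disc lifts
      and there is a contact point.\<close>
    have "gu p \<noteq> 0" using p(2) M1 \<delta> by auto
    then obtain R s z where R: "R > 0" "section_on X f (cball (f p) R) s" "lifts_ball p R s"
      "z \<in> sphere (f p) R" "s z \<in> bdry X f"
      using maximal_lifted_ball[OF p(1)] gradient_zero_if_plane_lifts by blast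
    have "2 * (M - norm (gu p)) / (1 - t) \<le> 2 * \<delta> / (1 - t)"
      using p(2) rt by (intro divide_right_mono) auto
    then show ?thesis using contact_estimate(2)[OF R M rt] by linarith
  qed
  \<comment> \<open>The order of limits matters: \<delta> tends to 0 with \<open>t\<close> fixed, as
    the error is 2 \<delta> / (1 - t); only afterwards does \<open>t\<close> tend to 1.\<close>
  have key2: "M * t \<le> M * r + 2 * (1 - r) / (1 + r)" if rt: "0 < r" "r < 1" "0 < t" "t < 1" for r t
  proof (rule field_le_epsilon)
    fix k :: real assume k: "k > 0"
    define \<delta> where "\<delta> = min (1/2) (k * (1 - t) / 2)"
    have \<delta>: "0 < \<delta>" "\<delta> < 1" using k rt by (auto simp: \<delta>_def)
    have "2 * \<delta> \<le> k * (1 - t)" by (simp add: \<delta>_def)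
    then have "2 * \<delta> / (1 - t) \<le> k" using rt by (simp add: divide_le_eq)
    then show "M * t \<le> M * r + 2 * (1 - r) / (1 + r) + k" using key[OF \<delta> rt] by linarith
  qed
  have key3: "M \<le> M * r + 2 * (1 - r) / (1 + r)" if r: "0 < r" "r < 1" for r
  proof (rule field_le_epsilon)
    fix k :: real assume k: "k > 0"
    define t where "t = max (1/2) (1 - k / M)"
    have t: "0 < t" "t < 1" using k M1 by (auto simp: t_def)
    have "1 - k / M \<le> t" by (simp add: t_def)
    then have "M * (1 - k / M) \<le> M * t" using M1 by (intro mult_left_mono) auto
    then have "M - k \<le> M * t" using M1 by (simp add: algebra_simps)
    then show "M \<le> M * r + 2 * (1 - r) / (1 + r) + k" using key2[OF r t] by linarith
  qed
  \<comment> \<open>Cancelling 1 - r in \<open>key3\<close> leaves M (1 + r) \<le> 2. With r = 1 / M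
    this reads M + 1 \<le> 2.\<close>
  define r where "r = 1 / M"
  have r: "0 < r" "r < 1" using M1 by (auto simp: r_def)
  have "M * (1 - r) \<le> 2 / (1 + r) * (1 - r)" using key3[OF r] by (simp add: algebra_simps)
  then have "M \<le> 2 / (1 + r)" by (rule mult_right_le_imp_le) (use r in simp)
  then have "M * (1 + r) \<le> 2" using r by (simp add: pos_le_divide_eq)
  then show False using M1 by (simp add: r_def algebra_simps)
qed

section \<open>Affine continuation from a point of unit gradient\<close>

text \<open>The radius is pinned to \<open>u p\<close> from both sides: the contact point is a zero
  of an affine function of slope 1 at distance \<open>R\<close>, and at the lowest point of the
  closed disc its value \<open>u p - R\<close> is nonnegative.\<close>

lemma lifted_ball_of_unit_gradient:
  assumes p: "p \<in> interior_pts X f" and a: "norm (gu p) = 1"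
  shows "\<exists>s. lifts_ball p (u p) s \<and>
    (\<forall>z\<in>ball (f p) (u p). gu (s z) = gu p \<and> u (s z) = u p + gu p \<bullet> (z - f p))"
proof -
  have "gu p \<noteq> 0" using a by auto
  then obtain R s z where R: "R > 0" and s: "section_on X f (cball (f p) R) s" "lifts_ball p R s"
    and z: "z \<in> sphere (f p) R" "s z \<in> bdry X f"
    using maximal_lifted_ball[OF p] gradient_zero_if_plane_lifts by blast
  define B where "B = ball (f p) R"
  have sB: "section_on X f B s" "s (f p) = p" "s ` B \<subseteq> interior_pts X f"
    using s(2) by (auto simp: lifts_ball_def B_def)
  have "(\<lambda>z. cnj (gu (s z))) constant_on B"
  proof (rule maximum_modulus_principle[where U = B and \<xi> = "f p"])
    show "(\<lambda>z. cnj (gu (s z))) holomorphic_on B"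
      using section_gradient_holomorphic[OF sB(1) _ sB(3)] by (simp add: B_def)
    show "norm (cnj (gu (s w))) \<le> norm (cnj (gu (s (f p))))" if "w \<in> B" for w
      using gradient_le_1[of "s w"] sB a that by auto
  qed (use R in \<open>auto simp: B_def\<close>)
  then obtain k where k: "\<And>w. w \<in> B \<Longrightarrow> cnj (gu (s w)) = k" by (auto simp: constant_on_def)
  have "f p \<in> B" using R by (simp add: B_def)
  then have g: "gu (s w) = gu p" if "w \<in> B" for w
    using k[OF that] k[of "f p"] sB(2) complex_cnj_cancel_iff by metis
  define d where "d w = u (s w) - gu p \<bullet> (w - f p)" for w
  have "(d has_derivative (\<lambda>h. 0)) (at w within B)" if "w \<in> B" for w
  proof -
    have "((\<lambda>w. u (s w)) has_derivative (\<lambda>h. gu p \<bullet> h)) (at w)"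
      using section_gradient[OF sB(1) _ that sB(3)] g[OF that] by (simp add: B_def)
    then have "(d has_derivative (\<lambda>h. gu p \<bullet> h - gu p \<bullet> h)) (at w)"
      unfolding d_def by (auto intro!: derivative_eq_intros)
    then show ?thesis by (simp add: has_derivative_at_withinI)
  qed
  then obtain k where k: "\<And>w. w \<in> B \<Longrightarrow> d w = k"
    using has_derivative_zero_constant[of B d] by (auto simp: B_def)
  have dB: "d w = u p" if "w \<in> B" for w
    using k[OF that] k[OF \<open>f p \<in> B\<close>] sB(2) by (simp add: d_def)
  have clB: "closure B = cball (f p) R" using R by (simp add: B_def)
  have "continuous_on (closure B) d"
    unfolding clB d_def by (intro continuous_intros continuous_on_section_u[OF s(1)])
  then have dc: "d w = u p" if "w \<in> cball (f p) R" for w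
    using continuous_constant_on_closure[of B d "u p" w] dB that clB by simp
  have "u p \<le> R"
  proof -
    have "u p + gu p \<bullet> (z - f p) = 0" using dc[of z] z u_bdry by (simp add: d_def)
    moreover have "\<bar>gu p \<bullet> (z - f p)\<bar> \<le> R"
      using Cauchy_Schwarz_ineq2[of "gu p" "z - f p"] a z by (simp add: dist_norm norm_minus_commute)
    ultimately show ?thesis by linarith
  qed
  moreover have "u p \<ge> R"
  proof -
    define w where "w = f p - of_real R * gu p"
    have w: "w \<in> cball (f p) R" using a R by (simp add: w_def dist_norm norm_mult)
    have "gu p \<bullet> gu p = 1" using a by (simp add: dot_square_norm)
    then have "gu p \<bullet> (of_real R * gu p) = R" by (simp add: scaleR_conv_of_real[symmetric])
    then have "u (s w) = u p - R" using dc[OF w] by (simp add: d_def w_def)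
    then show ?thesis using u_nonneg[OF section_on_topspace[OF s(1) w]] by simp
  qed
  ultimately have "R = u p" by simp
  have "u (s w) = u p + gu p \<bullet> (w - f p)" if "w \<in> B" for w using dB[OF that] by (simp add: d_def)
  then show ?thesis using s(2) g \<open>R = u p\<close> unfolding B_def by blast
qed

lemma half_plane_section:
  assumes p: "p \<in> interior_pts X f" and a: "norm (gu p) = 1"
  defines "H \<equiv> {z. gu p \<bullet> z > gu p \<bullet> f p - u p}"
  shows "\<exists>s. section_on X f H s \<and> s ` H \<subseteq> interior_pts X f \<and>
    (\<forall>z\<in>H. gu (s z) = gu p \<and> u (s z) = u p + gu p \<bullet> (z - f p))"
proof -
  define c m where "c = f p" and "m = u p"
  define a where "a = gu p"
  have na: "norm a = 1" using a by (simp add: a_def)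
  have aa: "a \<bullet> a = 1" using na by (simp add: dot_square_norm)
  have m: "m > 0" using u_pos[OF p] by (simp add: m_def)
  \<comment> \<open>All discs \<open>B n\<close> touch the boundary line of \<open>H\<close> at the
    same point c - m a, since at each centre \<open>u\<close> equals the radius m + T n. Steps of
    m/2 keep the next centre inside the current disc, where \<open>u\<close> and \<open>gu\<close>
    are known.\<close>
  define T where "T n = real n * (m / 2)" for n
  define B where "B n = ball (c + T n *\<^sub>R a) (m + T n)" for n
  have T0: "T n \<ge> 0" for n using m by (simp add: T_def)
  have cB: "c \<in> B n" for n using T0[of n] m na by (simp add: B_def dist_norm)
  define Q where "Q n \<sigma> \<longleftrightarrow> section_on X f (B n) \<sigma> \<and> \<sigma> c = p \<and> \<sigma> ` B n \<subseteq> interior_pts X f \<and>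
    (\<forall>z\<in>B n. gu (\<sigma> z) = a \<and> u (\<sigma> z) = m + a \<bullet> (z - c))" for n \<sigma>
  have exQ: "\<exists>\<sigma>. Q n \<sigma>" for n
  proof (induction n)
    case 0
    show ?case using lifted_ball_of_unit_gradient[OF p a]
      by (auto simp: Q_def B_def T_def lifts_ball_def c_def m_def a_def)
  next
    case (Suc n)
    then obtain \<sigma> where \<sigma>: "section_on X f (B n) \<sigma>" "\<sigma> c = p" "\<sigma> ` B n \<subseteq> interior_pts X f"
      "\<And>z. z \<in> B n \<Longrightarrow> gu (\<sigma> z) = a \<and> u (\<sigma> z) = m + a \<bullet> (z - c)" by (auto simp: Q_def)
    define b where "b = c + T (Suc n) *\<^sub>R a"
    have TS: "T (Suc n) = T n + m / 2" by (simp add: T_def algebra_simps)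
    have "c + T n *\<^sub>R a - b = (- (m/2)) *\<^sub>R a" by (simp add: b_def TS algebra_simps)
    then have "dist (c + T n *\<^sub>R a) b = m / 2" using na m by (simp add: dist_norm)
    then have bB: "b \<in> B n" using m T0[of n] by (simp add: B_def)
    define q where "q = \<sigma> b"
    have q: "q \<in> interior_pts X f" "f q = b" "gu q = a" "u q = m + T (Suc n)"
      using \<sigma> bB aa by (auto simp: q_def section_on_def b_def)
    obtain \<sigma>' where \<sigma>': "lifts_ball q (u q) \<sigma>'"
      "\<And>z. z \<in> ball (f q) (u q) \<Longrightarrow> gu (\<sigma>' z) = gu q \<and> u (\<sigma>' z) = u q + gu q \<bullet> (z - f q)"
      using lifted_ball_of_unit_gradient[OF q(1)] na q(3) by auto
    have BS: "ball (f q) (u q) = B (Suc n)" by (simp add: q B_def b_def)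
    have sub: "B n \<subseteq> B (Suc n)"
    proof
      fix z assume "z \<in> B n"
      then have "dist z (c + T n *\<^sub>R a) < m + T n" by (simp add: B_def dist_commute)
      then have "dist z b < m + T n + m / 2"
        using dist_triangle[of z b "c + T n *\<^sub>R a"] \<open>dist (c + T n *\<^sub>R a) b = m / 2\<close> by linarith
      then show "z \<in> B (Suc n)" by (simp add: B_def b_def TS dist_commute)
    qed
    have "\<sigma>' c = \<sigma> c"
    proof (rule section_unique[where A = "B n"])
      show "section_on X f (B n) \<sigma>'" using \<sigma>'(1) BS section_on_subset[OF _ sub] by (auto simp: lifts_ball_def)
      show "\<sigma>' b = \<sigma> b" using \<sigma>'(1) q by (simp add: lifts_ball_def q_def)
    qed (use \<sigma>(1) bB cB in \<open>auto simp: B_def\<close>)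
    moreover have "gu (\<sigma>' z) = a \<and> u (\<sigma>' z) = m + a \<bullet> (z - c)" if "z \<in> B (Suc n)" for z
      using \<sigma>'(2)[of z, unfolded BS, OF that] q aa by (simp add: b_def inner_diff_right inner_add_right)
    ultimately have "Q (Suc n) \<sigma>'" using \<sigma>'(1) \<sigma>(2) BS by (auto simp: Q_def lifts_ball_def)
    then show ?case by blast
  qed
  then obtain \<sigma> where \<sigma>: "\<And>n. Q n (\<sigma> n)" by metis
  have sec: "section_on X f (B n) (\<sigma> n)" for n using \<sigma>[of n] by (simp add: Q_def)
  have opB: "open (B n)" for n by (simp add: B_def)
  have agree: "\<sigma> i z = \<sigma> j z" if "z \<in> B i" "z \<in> B j" for i j z
  proof (rule section_unique[where A = "B i \<inter> B j" and a = c])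
    show "section_on X f (B i \<inter> B j) (\<sigma> i)" "section_on X f (B i \<inter> B j) (\<sigma> j)"
      using section_on_subset[OF sec] by blast+
    show "connected (B i \<inter> B j)" by (simp add: B_def convex_connected convex_Int)
    show "\<sigma> i c = \<sigma> j c" using \<sigma>[of i] \<sigma>[of j] by (simp add: Q_def)
  qed (use that cB in auto)
  obtain s where s: "section_on X f (\<Union>n. B n) s" "\<And>n z. z \<in> B n \<Longrightarrow> s z = \<sigma> n z"
    using glue_sections[of UNIV B X f \<sigma>, OF opB sec agree] by blast
  have HB: "\<exists>n. z \<in> B n" if z: "z \<in> H" for z
  proof -
    define w where "w = z - c"
    have pos: "m + a \<bullet> w > 0" using z by (simp add: H_def w_def a_def c_def m_def inner_diff_right)
    \<comment> \<open>Squaring |w - (T n) a| < m + T n leaves |w|^2 - m^2 < 2 (T n) (m + a \<bullet>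
      w), which is linear in T n = n m / 2 with a positive factor.\<close>
    obtain n :: nat where n: "real n > ((norm w)\<^sup>2 - m\<^sup>2) / (m * (m + a \<bullet> w))" using reals_Archimedean2 by blast
    then have "(norm w)\<^sup>2 - m\<^sup>2 < 2 * T n * (m + a \<bullet> w)"
      using pos m by (simp add: T_def divide_less_eq mult_ac)
    then have "(norm (w - T n *\<^sub>R a))\<^sup>2 < (m + T n)\<^sup>2"
      unfolding power2_norm_eq_inner by (simp add: inner_diff_left inner_diff_right aa inner_commute power2_eq_square algebra_simps)
    then have "norm (w - T n *\<^sub>R a) < m + T n" using T0[of n] m by (simp add: power_less_imp_less_base)
    then have "dist (c + T n *\<^sub>R a) z < m + T n" by (simp add: w_def dist_norm norm_minus_commute algebra_simps)
    then show ?thesis by (auto simp: B_def)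
  qed
  show ?thesis
  proof (intro exI[of _ s] conjI ballI image_subsetI)
    show "section_on X f H s" using section_on_subset[OF s(1)] HB by blast
    fix z assume "z \<in> H"
    then obtain n where "z \<in> B n" using HB by blast
    then show "s z \<in> interior_pts X f" "gu (s z) = gu p" "u (s z) = u p + gu p \<bullet> (z - f p)"
      using s(2)[of z n] \<sigma>[of n] by (auto simp: Q_def a_def c_def m_def)
  qed
qed

end

section \<open>The equality case\<close>

lemma chart_on_subset:
  assumes U: "chart_on X f U" and V: "openin X V" "V \<subseteq> U" shows "chart_on X f V"
proof -
  have "homeomorphic_map (subtopology X U) (top_of_set (f ` U)) f" using U by (simp add: chart_on_def)
  moreover have "f ` (topspace (subtopology X U) \<inter> V) = topspace (top_of_set (f ` U)) \<inter> f ` V"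
    using openin_subset[OF V(1)] V(2) by auto
  ultimately have "homeomorphic_map (subtopology (subtopology X U) V) (subtopology (top_of_set (f ` U)) (f ` V)) f"
    by (rule homeomorphic_map_subtopologies)
  moreover have "subtopology (subtopology X U) V = subtopology X V"
    using V(2) by (simp add: subtopology_subtopology inf_absorb2)
  moreover have "subtopology (top_of_set (f ` U)) (f ` V) = top_of_set (f ` V)"
    using V(2) by (simp add: subtopology_subtopology inf_absorb2 image_mono)
  ultimately show ?thesis using V(1) by (simp add: chart_on_def)
qed

context flat_surface begin

lemma openin_preimage_developing_map:
  assumes "openin X U" "open V" shows "openin X {x \<in> U. f x \<in> V}"
proof -
  have "openin X {x \<in> topspace X. f x \<in> V}"
    using openin_continuous_map_preimage[OF continuous_developing_map, of V] assms by simp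
  then have "openin X (U \<inter> {x \<in> topspace X. f x \<in> V})" using assms by blast
  moreover have "U \<inter> {x \<in> topspace X. f x \<in> V} = {x \<in> U. f x \<in> V}" using openin_subset[OF assms(1)] by auto
  ultimately show ?thesis by simp
qed

lemma openin_interior_pts: "openin X (interior_pts X f)"
  by (subst openin_subopen) (meson chart_on_openin interior_pts_chart)

text \<open>Over the open strict supergraph the chart consists of interior points, and points just
  above the graph come arbitrarily close to \<open>x\<close>.\<close>

lemma interior_dense:
  assumes N: "openin X N" and x: "x \<in> N" shows "N \<inter> interior_pts X f \<noteq> {}"
proof -
  have xt: "x \<in> topspace X" using N x openin_subset by blast
  with immersed have "local_model X f x" by (simp add: immersed_domain_def)
  then obtain U W where UW: "x \<in> U" "chart_on X f U" "open W" and alt: "f ` U = W \<or>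
       (\<exists>a c h. norm a = 1 \<and> smooth_real h \<and> f ` U = W \<inter> {z. Im (a * (z - c)) \<ge> h (Re (a * (z - c)))})"
    unfolding local_model_def by blast
  from alt show ?thesis
  proof
    assume "f ` U = W" then show ?thesis using UW xt x by (auto simp: interior_pts_def interior_pt_def)
  next
    assume "\<exists>a c h. norm a = 1 \<and> smooth_real h \<and> f ` U = W \<inter> {z. Im (a * (z - c)) \<ge> h (Re (a * (z - c)))}"
    then obtain a c h where a: "norm a = 1" and h: "smooth_real h"
      and eq: "f ` U = W \<inter> {z. Im (a * (z - c)) \<ge> h (Re (a * (z - c)))}" by blast
    have "h differentiable (at x)" for x using h[unfolded smooth_real_def, rule_format, of 0 x] by simp
    then have "continuous_on UNIV h" by (simp add: continuous_at_imp_continuous_on differentiable_imp_continuous_within)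
    then have conth: "continuous_on UNIV (\<lambda>z. h (Re (a * (z - c))))"
      by (rule continuous_on_compose2) (auto intro!: continuous_intros)
    define G where "G = {z. h (Re (a * (z - c))) < Im (a * (z - c))}"
    have G: "open G" unfolding G_def using conth by (intro open_Collect_less continuous_intros)
    define V where "V = {y \<in> U. f y \<in> G}"
    have V: "openin X V" unfolding V_def using chart_on_openin[OF UW(2)] G by (rule openin_preimage_developing_map)
    have "f ` V = W \<inter> G" using eq by (force simp: V_def G_def)
    then have "open (f ` V)" using UW(3) G by (simp add: open_Int)
    moreover have "chart_on X f V" using chart_on_subset[OF UW(2) V] by (simp add: V_def)
    ultimately have Vint: "V \<subseteq> interior_pts X f"
      using openin_subset[OF V] unfolding interior_pts_def interior_pt_def by blast
    have xU: "f x \<in> f ` U" "inv_into U f (f x) = x" using UW(1) chart_on_section_eq[OF UW(2)] by auto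
    obtain r1 where r1: "r1 > 0" "inv_into U f ` (f ` U \<inter> ball (f x) r1) \<subseteq> N"
      using section_on_local_preimage[OF chart_on_section[OF UW(2)] xU(1) N] x xU(2) by auto
    have "f x \<in> W" using xU eq by auto
    then obtain r2 where r2: "r2 > 0" "ball (f x) r2 \<subseteq> W" using UW(3) open_contains_ball by blast
    define k where "k = min r1 r2 / 2"
    have k: "k > 0" using r1 r2 by (simp add: k_def)
    \<comment> \<open>As a * cnj a = 1, this shift becomes a purely vertical one by k after the
      rigid motion: it raises Im and keeps Re.\<close>
    define w where "w = f x + of_real k * (\<i> * cnj a)"
    have "dist (f x) w = k" using a k by (simp add: w_def dist_norm norm_mult)
    moreover have "k < min r1 r2" using k unfolding k_def by linarith
    ultimately have dw: "dist (f x) w < min r1 r2" by simp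
    have "a * cnj a = 1" using a complex_norm_square[of a] by simp
    then have aw: "a * (w - c) = a * (f x - c) + of_real k * \<i>"
      by (simp add: w_def algebra_simps)
    have "h (Re (a * (f x - c))) \<le> Im (a * (f x - c))" using xU(1) eq by auto
    then have "w \<in> G" unfolding G_def mem_Collect_eq aw using k by simp
    moreover have "w \<in> W" using dw r2 by auto
    ultimately have wU: "w \<in> f ` U" using eq by (auto simp: G_def)
    have "inv_into U f w \<in> V" using inv_into_into[OF wU] f_inv_into_f[OF wU] \<open>w \<in> G\<close> by (simp add: V_def)
    moreover have "inv_into U f w \<in> N" using r1(2) wU dw by auto
    ultimately show ?thesis using Vint by blast
  qed
qed

lemma open_image_of_interior:
  assumes V: "openin X V" "V \<subseteq> interior_pts X f" shows "open (f ` V)"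
  unfolding open_contains_ball
proof
  fix z assume "z \<in> f ` V"
  then obtain v where v: "v \<in> V" "z = f v" by blast
  then have "v \<in> interior_pts X f" using V(2) by blast
  then obtain U where U: "v \<in> U" "chart_on X f U" "open (f ` U)" by (rule interior_pts_chart)
  have zU: "z \<in> f ` U" "inv_into U f z = v" using U(1) v(2) chart_on_section_eq[OF U(2)] by auto
  obtain r1 where r1: "r1 > 0" "inv_into U f ` (f ` U \<inter> ball z r1) \<subseteq> V"
    using section_on_local_preimage[OF chart_on_section[OF U(2)] zU(1) V(1)] zU(2) v(1) by auto
  obtain r2 where r2: "r2 > 0" "ball z r2 \<subseteq> f ` U" using U(3) zU(1) open_contains_ball by blast
  have "w \<in> f ` V" if "w \<in> ball z (min r1 r2)" for w
  proof -
    have "w \<in> f ` U" "w \<in> ball z r1" using that r2(2) by auto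
    then have "inv_into U f w \<in> V" using r1(2) by blast
    then show ?thesis using f_inv_into_f[OF \<open>w \<in> f ` U\<close>] by (metis image_eqI)
  qed
  then show "\<exists>e>0. ball z e \<subseteq> f ` V" using r1(1) r2(1) by (intro exI[of _ "min r1 r2"]) auto
qed

text \<open>The image consists of the points over \<open>C\<close> that \<open>s \<circ> f\<close>
  fixes, an equaliser in a Hausdorff space.\<close>

lemma closed_section_image:
  assumes s: "section_on X f C s" and C: "closed C" shows "closedin X (s ` C)"
proof -
  define D where "D = {x \<in> topspace X. f x \<in> C}"
  have D: "closedin X D"
    using closedin_continuous_map_preimage[OF continuous_developing_map, of C] C by (simp add: D_def)
  have Dt: "D \<subseteq> topspace X" by (auto simp: D_def)
  have "continuous_map (subtopology X D) (top_of_set C) f"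
    using continuous_map_from_subtopology[OF continuous_developing_map, of D]
    by (auto simp: continuous_map_in_subtopology D_def)
  then have "continuous_map (subtopology X D) X (s \<circ> f)"
    using s unfolding section_on_def by (blast intro: continuous_map_compose)
  moreover have "continuous_map (subtopology X D) X id"
    by (simp add: continuous_map_from_subtopology)
  ultimately have "closedin (subtopology X D) {x \<in> topspace (subtopology X D). (s \<circ> f) x = id x}"
    using Hausdorff by (intro closedin_continuous_maps_eq)
  moreover have "{x \<in> topspace (subtopology X D). (s \<circ> f) x = id x} = s ` C"
  proof -
    have "x \<in> s ` C" if "x \<in> D" "s (f x) = x" for x
      using that by (metis (mono_tags, lifting) D_def image_eqI mem_Collect_eq)
    moreover have "s z \<in> D" "s (f (s z)) = s z" if "z \<in> C" for z
      using that s section_on_topspace[OF s that] by (auto simp: D_def section_on_def)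
    ultimately show ?thesis using Dt by auto
  qed
  ultimately have "closedin (subtopology X D) (s ` C)" by simp
  then show ?thesis using D closedin_trans_full by blast
qed

end

section \<open>The lifted half-plane is the whole surface\<close>

context overdetermined_solution begin

text \<open>
  From an interior point outside \<open>C\<close>, move in direction \<open>a\<close>: \<open>u\<close> is positive and increases as long as the
  path stays in the interior, but before or when it reaches the boundary line of \<open>C\<close> it must hit a
  boundary point of the surface, where \<open>u = 0\<close>.
\<close>

lemma interior_pt_in_half_plane:
  assumes a: "norm a = 1" and C: "C = {w. a \<bullet> w \<ge> b}"
    and s: "section_on X f C s" and us: "\<And>w. w \<in> C \<Longrightarrow> u (s w) = a \<bullet> w - b"
    and U: "chart_on X f U" "open W" "closed S" "f ` U = W \<inter> S"
    and z: "z \<in> C" and rW: "ball z r \<subseteq> W" and sU: "s ` (C \<inter> ball z r) \<subseteq> U"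
    and gpos: "\<And>y. y \<in> U \<Longrightarrow> f y \<in> ball z r \<Longrightarrow> gu y \<bullet> a > 0"
    and x: "x \<in> U" "x \<in> interior_pts X f" "f x \<in> ball z r"
  shows "f x \<in> C"
proof (rule ccontr)
  assume "f x \<notin> C"
  define V where "V = U \<inter> interior_pts X f"
  have V: "openin X V" unfolding V_def using chart_on_openin[OF U(1)] openin_interior_pts by (rule openin_Int)
  have oV: "open (f ` V)" using open_image_of_interior[OF V] by (simp add: V_def)
  have aa: "a \<bullet> a = 1" using a by (simp add: dot_square_norm)
  define t1 where "t1 = b - a \<bullet> f x"
  have t1: "t1 > 0" using \<open>f x \<notin> C\<close> C by (simp add: t1_def)
  define w where "w t = f x + t *\<^sub>R a" for t
  have w0: "w 0 = f x" by (simp add: w_def)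
  \<comment> \<open>Since \<open>z\<close> lies on or beyond the boundary line, moving towards that
    line does not increase the distance to \<open>z\<close>; the path stays where the chart and the
    sign of the slope are under control.\<close>
  have wb: "w t \<in> ball z r" if t: "0 \<le> t" "t \<le> t1" for t
  proof -
    have "a \<bullet> (f x - z) \<le> - t1" using z C by (simp add: t1_def inner_diff_right)
    then have "2 * t * (a \<bullet> (f x - z)) \<le> 2 * t * (- t1)" using t by (intro mult_left_mono) auto
    moreover have "t * t \<le> t * t1" using t by (intro mult_left_mono) auto
    moreover have "0 \<le> t * t1" using t t1 by simp
    ultimately have "2 * t * (a \<bullet> (f x - z)) + t * t \<le> 0" by (simp add: mult_ac)
    moreover have "(norm ((f x - z) + t *\<^sub>R a))\<^sup>2 = (norm (f x - z))\<^sup>2 + (2 * t * (a \<bullet> (f x - z)) + t * t)"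
      unfolding power2_norm_eq_inner by (simp add: inner_add_left inner_add_right aa inner_commute)
    ultimately have "norm ((f x - z) + t *\<^sub>R a) \<le> norm (f x - z)" by (simp add: power2_le_imp_le)
    moreover have "w t - z = (f x - z) + t *\<^sub>R a" by (simp add: w_def)
    ultimately have "dist z (w t) \<le> dist z (f x)" by (metis dist_norm dist_commute)
    then show ?thesis using x(3) by simp
  qed
  have contw: "continuous_on A w" for A unfolding w_def by (intro continuous_intros)
  \<comment> \<open>The times at which the path is outside the interior part of the chart; the least
    one is the first exit.\<close>
  define E where "E = {0..t1} \<inter> w -` (- f ` V)"
  have E: "closed E" unfolding E_def using oV contw by (intro continuous_closed_preimage) auto
  have "w t1 \<in> C" using C by (simp add: w_def t1_def inner_add_right aa)
  \<comment> \<open>On the boundary line \<open>u\<close> vanishes along \<open>s\<close>, and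
    injectivity of the chart leaves no other point over \<open>w t1\<close> in \<open>U\<close>; an
    interior point would have positive \<open>u\<close>.\<close>
  have "w t1 \<notin> f ` V"
  proof
    assume "w t1 \<in> f ` V"
    then obtain v where v: "v \<in> V" "w t1 = f v" by blast
    have "s (w t1) \<in> U" using sU \<open>w t1 \<in> C\<close> wb[of t1] t1 by auto
    moreover have "f (s (w t1)) = f v" using s \<open>w t1 \<in> C\<close> v by (simp add: section_on_def)
    ultimately have "s (w t1) = v" using chart_on_inj[OF U(1)] v by (auto simp: inj_on_def V_def)
    moreover have "u (s (w t1)) = 0" using us[OF \<open>w t1 \<in> C\<close>] by (simp add: w_def t1_def inner_add_right aa)
    ultimately show False using u_pos[of v] v by (simp add: V_def)
  qed
  then have t1E: "t1 \<in> E" using t1 by (simp add: E_def)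
  define t' where "t' = Inf E"
  have bdd: "bdd_below E" by (auto simp: E_def bdd_below_def)
  have t'E: "t' \<in> E" unfolding t'_def using closed_contains_Inf[OF _ bdd E] t1E by blast
  have "w 0 \<in> f ` V" using x w0 by (auto simp: V_def)
  then have t': "0 < t'" "t' \<le> t1" using t'E by (auto simp: E_def less_le)
  have before: "w t \<in> f ` V" if "0 \<le> t" "t < t'" for t
  proof (rule ccontr)
    assume "w t \<notin> f ` V"
    then have "t \<in> E" using that t' by (simp add: E_def)
    then have "t' \<le> t" unfolding t'_def using bdd by (rule cInf_lower)
    then show False using that by simp
  qed
  \<comment> \<open>Closedness of \<open>S\<close> keeps the exit point in the chart image, so it
    comes from a point of the surface, which then has to be a boundary point.\<close>
  have "{0..t'} \<subseteq> w -` S"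
  proof -
    have "w t \<in> S" if "0 \<le> t" "t < t'" for t using before[OF that] U(4) by (auto simp: V_def)
    then have "{0..<t'} \<subseteq> w -` S" by auto
    moreover have "closed (w -` S)" using contw U(3) by (simp add: closed_vimage continuous_on_eq_continuous_at)
    ultimately have "closure {0..<t'} \<subseteq> w -` S" by (rule closure_minimal)
    then show ?thesis using t' by simp
  qed
  then have wU: "w t \<in> f ` U" if "0 \<le> t" "t \<le> t'" for t
    using wb[of t] rW that t' U(4) by auto
  define v where "v t = inv_into U f (w t)" for t
  have vU: "v t \<in> U" "f (v t) = w t" if "0 \<le> t" "t \<le> t'" for t
    using inv_into_into[OF wU[OF that]] f_inv_into_f[OF wU[OF that]] by (auto simp: v_def)
  have "v t' \<notin> interior_pts X f"
  proof
    assume "v t' \<in> interior_pts X f"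
    then have "f (v t') \<in> f ` V" using vU(1)[of t'] t' by (simp add: V_def)
    then show False using vU(2)[of t'] t' t'E by (simp add: E_def)
  qed
  moreover have "v t' \<in> topspace X" using vU[of t'] t' openin_subset[OF chart_on_openin[OF U(1)]] by auto
  ultimately have uv': "u (v t') = 0" using u_bdry bdry_iff by blast
  have v0: "v 0 = x" using chart_on_section_eq[OF U(1) x(1)] by (simp add: v_def w0)
  have cont: "continuous_on {0..t'} (\<lambda>t. u (v t))"
    unfolding v_def
    by (rule continuous_on_compose2[OF continuous_on_section_u[OF chart_on_section[OF U(1)]] contw]) (use wU in auto)
  have secV: "section_on X f (f ` V) (inv_into U f)"
    by (rule section_on_subset[OF chart_on_section[OF U(1)]]) (auto simp: V_def)
  have invV: "inv_into U f ` (f ` V) \<subseteq> interior_pts X f"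
    using chart_on_section_eq[OF U(1)] by (auto simp: V_def)
  have der: "((\<lambda>t. u (v t)) has_derivative (\<lambda>h. h * (gu (v t) \<bullet> a))) (at t)" if t: "0 < t" "t < t'" for t
  proof -
    have "(w has_derivative (\<lambda>h. h *\<^sub>R a)) (at t)" unfolding w_def by (auto intro!: derivative_eq_intros)
    moreover have "((\<lambda>y. u (inv_into U f y)) has_derivative (\<lambda>h. gu (inv_into U f (w t)) \<bullet> h)) (at (w t))"
      using section_gradient[OF secV oV _ invV] before[of t] t by simp
    ultimately have "((\<lambda>t. u (inv_into U f (w t))) has_derivative (\<lambda>h. gu (inv_into U f (w t)) \<bullet> (h *\<^sub>R a))) (at t)"
      by (rule has_derivative_compose)
    then show ?thesis by (simp add: v_def)
  qed
  from mvt[OF t'(1) cont der] obtain t where t: "0 < t" "t < t'" "u (v t') - u (v 0) = (t' - 0) * (gu (v t) \<bullet> a)"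
    by blast
  have "gu (v t) \<bullet> a > 0" using gpos[of "v t"] vU[of t] wb[of t] t t' by auto
  then have "(t' - 0) * (gu (v t) \<bullet> a) > 0" using t' by simp
  then show False using t(3) uv' v0 u_pos[OF x(2)] by simp
qed

text \<open>The image is closed and nonempty, so by connectedness only openness is at stake. Near an
  image point, interior points lie over \<open>C\<close> by the preceding lemma, the remaining ones
  by density of the interior, and injectivity of the chart identifies them with values of
  \<open>s\<close>.\<close>

lemma half_plane_section_surjective:
  assumes a: "norm a = 1" and C: "C = {w. a \<bullet> w \<ge> b}"
    and s: "section_on X f C s" and us: "\<And>w. w \<in> C \<Longrightarrow> u (s w) = a \<bullet> w - b"
    and gs: "\<And>w. w \<in> C \<Longrightarrow> gu (s w) = a"
  shows "s ` C = topspace X"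
proof -
  have aa: "a \<bullet> a = 1" using a by (simp add: dot_square_norm)
  have cC: "closed C" "convex C" unfolding C by (auto simp: closed_halfspace_ge convex_halfspace_ge)
  have "openin X (s ` C)"
  proof (subst openin_subopen, intro ballI)
    fix y assume "y \<in> s ` C"
    then obtain z where z: "z \<in> C" "y = s z" by blast
    have y: "y \<in> topspace X" "f y = z" using s z section_on_topspace[OF s z(1)] by (auto simp: section_on_def)
    obtain U W S where U: "y \<in> U" "chart_on X f U" "open W" "closed S" "f ` U = W \<inter> S"
      using local_chart[OF y(1)] .
    define P where "P = {x \<in> topspace X. gu x \<in> {g. g \<bullet> a > 0}}"
    have "open {g. g \<bullet> a > 0}" by (intro open_Collect_less continuous_intros)
    then have P: "openin X P" unfolding P_def using openin_continuous_map_preimage[OF gu_continuous, of "{g. g \<bullet> a > 0}"] by simp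
    have yP: "y \<in> P" using gs[OF z(1)] z(2) y(1) aa by (simp add: P_def)
    have zU: "z \<in> f ` U" "inv_into U f z = y" using U(1) y(2) chart_on_section_eq[OF U(2,1)] by auto
    obtain r1 where r1: "r1 > 0" "inv_into U f ` (f ` U \<inter> ball z r1) \<subseteq> P"
      using section_on_local_preimage[OF chart_on_section[OF U(2)] zU(1) P] yP zU(2) by auto
    have "z \<in> W" using zU(1) U(5) by auto
    then obtain r2 where r2: "r2 > 0" "ball z r2 \<subseteq> W" using U(3) open_contains_ball by blast
    define r where "r = min r1 r2"
    have r: "r > 0" "ball z r \<subseteq> W" using r1 r2 by (auto simp: r_def)
    have sU: "s ` (C \<inter> ball z r) \<subseteq> U"
    proof (rule chart_absorbs[OF U(2,4,5)])
      show "connected (C \<inter> ball z r)" by (simp add: cC convex_Int convex_connected)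
      show "continuous_map (top_of_set (C \<inter> ball z r)) X s"
        using section_on_subset[OF s, of "C \<inter> ball z r"] by (simp add: section_on_def)
      show "f (s t) \<in> W" if "t \<in> C \<inter> ball z r" for t using that s r(2) by (auto simp: section_on_def)
      show "z \<in> C \<inter> ball z r" using z r by simp
      show "s z \<in> U" using z U by simp
    qed
    have gpos: "gu x \<bullet> a > 0" if "x \<in> U" "f x \<in> ball z r" for x
    proof -
      have "inv_into U f (f x) \<in> P" using r1(2) that by (auto simp: r_def)
      then show ?thesis using chart_on_section_eq[OF U(2) that(1)] by (simp add: P_def)
    qed
    note int = interior_pt_in_half_plane[OF a C s us U(2-5) z(1) r(2) sU gpos]
    have inC: "f x \<in> C" if x: "x \<in> U" "f x \<in> ball z r" for x
    proof (rule ccontr)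
      assume nC: "f x \<notin> C"
      define N where "N = {x \<in> U. f x \<in> ball z r - C}"
      have "openin X N" unfolding N_def using chart_on_openin[OF U(2)] cC(1)
        by (intro openin_preimage_developing_map) auto
      moreover have "x \<in> N" using x nC by (simp add: N_def)
      ultimately obtain x' where "x' \<in> N" "x' \<in> interior_pts X f" using interior_dense by blast
      then show False using int[of x'] by (auto simp: N_def)
    qed
    define N where "N = {x \<in> U. f x \<in> ball z r}"
    have "openin X N" unfolding N_def using chart_on_openin[OF U(2)] by (intro openin_preimage_developing_map) auto
    moreover have "y \<in> N" using U(1) y(2) r by (simp add: N_def)
    moreover have "N \<subseteq> s ` C"
    proof
      fix x assume "x \<in> N"
      then have x: "x \<in> U" "f x \<in> ball z r" by (auto simp: N_def)
      have "s (f x) \<in> U" using sU inC[OF x] x(2) by blast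
      moreover have "f (s (f x)) = f x" using s inC[OF x] by (simp add: section_on_def)
      ultimately have "s (f x) = x" using chart_on_inj[OF U(2)] x(1) by (simp add: inj_on_def)
      then show "x \<in> s ` C" using inC[OF x] by (metis image_eqI)
    qed
    ultimately show "\<exists>T. openin X T \<and> y \<in> T \<and> T \<subseteq> s ` C" by blast
  qed
  moreover have "closedin X (s ` C)" using closed_section_image[OF s cC(1)] .
  moreover have "connected_space X" using immersed by (simp add: immersed_domain_def)
  moreover have "b *\<^sub>R a \<in> C" using C aa by simp
  then have "s ` C \<noteq> {}" by blast
  ultimately show ?thesis unfolding connected_space_clopen_in by blast
qed

text \<open>\<open>h\<close> is \<open>f\<close> followed by the rigid motion that takes
  \<open>C\<close> to the upper half-plane. Path distance is at least plane distance for any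
  developing map, and at most that along a section over a convex set.\<close>

lemma isometric_to_half_plane_if_section:
  assumes a: "norm a = 1" and C: "C = {w. a \<bullet> w \<ge> b}"
    and s: "section_on X f C s" and surj: "s ` C = topspace X"
  shows "isometric_to_closed_halfplane X f"
  unfolding isometric_to_closed_halfplane_def
proof (intro exI conjI ballI)
  have ca: "a * cnj a = 1" "cnj a * a = 1" using a complex_norm_square[of a] by (auto simp: mult.commute)
  have dot: "a \<bullet> w = Re (cnj a * w)" for w by (simp add: inner_complex_def)
  define h where "h x = \<i> * (cnj a * f x - of_real b)" for x
  define k where "k y = a * (of_real b - \<i> * y)" for y
  have fs: "f x \<in> C" "s (f x) = x" if "x \<in> topspace X" for x
  proof -
    from that surj obtain z where "z \<in> C" "x = s z" by blast
    then show "f x \<in> C" "s (f x) = x" using s by (auto simp: section_on_def)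
  qed
  have cak: "cnj a * k y = of_real b - \<i> * y" for y
    using ca by (simp add: k_def mult.assoc[symmetric])
  have kC: "k y \<in> C" if "Im y \<ge> 0" for y
  proof -
    have "a \<bullet> k y = b + Im y" unfolding dot cak by simp
    then show ?thesis using that by (simp add: C)
  qed
  show "bij_betw h (topspace X) {z. Im z \<ge> 0}"
  proof (rule bij_betw_byWitness[where f' = "\<lambda>y. s (k y)"])
    show "\<forall>x\<in>topspace X. s (k (h x)) = x"
    proof
      fix x assume "x \<in> topspace X"
      moreover have "k (h x) = f x" using ca by (simp add: k_def h_def algebra_simps)
      ultimately show "s (k (h x)) = x" using fs by simp
    qed
    show "\<forall>y\<in>{z. Im z \<ge> 0}. h (s (k y)) = y"
    proof
      fix y assume "y \<in> {z. Im z \<ge> 0}"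
      then have "f (s (k y)) = k y" using kC s by (simp add: section_on_def)
      then show "h (s (k y)) = y" by (simp add: h_def cak algebra_simps)
    qed
    show "h ` topspace X \<subseteq> {z. Im z \<ge> 0}" using fs(1) by (auto simp: h_def C dot)
    show "(\<lambda>y. s (k y)) ` {z. Im z \<ge> 0} \<subseteq> topspace X" using kC surj by auto
  qed
  fix p q assume pq: "p \<in> topspace X" "q \<in> topspace X"
  have "h p - h q = \<i> * cnj a * (f p - f q)" by (simp add: h_def algebra_simps)
  then have "dist (h p) (h q) = dist (f p) (f q)" using a by (simp add: dist_norm norm_mult)
  moreover have "idist X f p q \<le> ereal (dist (f p) (f q))"
    using idist_section_le[OF s _ fs(1)[OF pq(1)] fs(1)[OF pq(2)]] fs(2) pq by (simp add: C convex_halfspace_ge)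
  ultimately show "idist X f p q = ereal (dist (h p) (h q))"
    using idist_ge[of f p q X] by (simp add: antisym)
qed

text \<open>Completeness extends the lift of the open half-plane to its closure, and continuity
  carries the formulas for \<open>u\<close> and \<open>gu\<close> to the boundary line, where
  surjectivity relies on them.\<close>

lemma isometric_to_half_plane_if_unit_gradient:
  assumes p: "p \<in> interior_pts X f" and na: "norm (gu p) = 1"
  shows "isometric_to_closed_halfplane X f"
proof -
  define a b where "a = gu p" and "b = gu p \<bullet> f p - u p"
  define H where "H = {z. a \<bullet> z > b}"
  define C where "C = {z. a \<bullet> z \<ge> b}"
  have a: "norm a = 1" "a \<noteq> 0" using na by (auto simp: a_def)
  have clH: "closure H = C" using a(2) by (simp add: H_def C_def closure_halfspace_gt)
  have cH: "convex H" by (simp add: H_def convex_halfspace_gt)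
  obtain s0 where s0: "section_on X f H s0"
    "\<And>z. z \<in> H \<Longrightarrow> gu (s0 z) = a \<and> u (s0 z) = u p + a \<bullet> (z - f p)"
    using half_plane_section[OF p na] unfolding H_def a_def b_def by blast
  obtain s where s: "section_on X f C s" "\<And>z. z \<in> H \<Longrightarrow> s z = s0 z"
    using section_extends_to_closure[OF s0(1) cH] unfolding clH by blast
  have gs: "gu (s z) = a" if "z \<in> C" for z
    using continuous_constant_on_closure[of H "\<lambda>z. gu (s z)" a z] continuous_on_section_gu[OF s(1)] s0(2) s(2) that
    by (simp add: clH)
  have us: "u (s z) = a \<bullet> z - b" if "z \<in> C" for z
  proof -
    have "u (s z) - a \<bullet> z = - b"
    proof (rule continuous_constant_on_closure[of H "\<lambda>z. u (s z) - a \<bullet> z"])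
      show "continuous_on (closure H) (\<lambda>z. u (s z) - a \<bullet> z)"
        unfolding clH by (intro continuous_intros continuous_on_section_u[OF s(1)])
      show "u (s w) - a \<bullet> w = - b" if "w \<in> H" for w
        using s0(2)[OF that] s(2)[OF that] by (simp add: b_def a_def inner_diff_right)
    qed (use that clH in simp)
    then show ?thesis by simp
  qed
  show ?thesis
    using isometric_to_half_plane_if_section[OF a(1) C_def s(1) half_plane_section_surjective[OF a(1) C_def s(1) us gs]] .
qed

end

theorem mainTheorem18:
  fixes X :: "'a topology" and f :: "'a \<Rightarrow> complex" and u :: "'a \<Rightarrow> real" and gu :: "'a \<Rightarrow> complex"
  assumes "exceptional X f"
    and "finite_connectivity X f"
    and "embedded_ends X f"
    and "\<not> isometric_to_closed_halfplane X f"
    and "associated_function X f u gu"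
  shows "\<forall>p\<in>interior_pts X f. norm (gu p) < 1"
proof
  interpret overdetermined_solution X f u gu
    using assms(1,5) by unfold_locales (auto simp: exceptional_def)
  fix p assume p: "p \<in> interior_pts X f"
  show "norm (gu p) < 1"
    using gradient_le_1[OF p] isometric_to_half_plane_if_unit_gradient[OF p] assms(4) by fastforce
qed

end
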